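(* Let $M>0$ and $a^2+Q^2=M^2$, and let $g_{M,a,Q}$ be the extremal Kerr-Newman metric on the exterior $r>M$. Consider $$\Box_{g_{M,a,Q}}u=0,\qquad\partial_\phi u=0,$$ with smooth future-horizon regular data. Then the future horizon $\mathcal H^+=\{r=M\}$ carries the conserved charge $$\mathfrak A_0[u](v)=\int_0^\pi\bigl(2(M^2+a^2)\partial_ru+2Mu+a^2\sin^2\theta\,\partial_vu\bigr)(v,M,\theta)\sin\theta\,d\theta,\qquad \frac{d}{dv}\mathfrak A_0[u](v)=0 .$$ Consequently the subextremal black-hole package, with its nondegenerate red-shift horizon estimate, does not extend to the extremal parameter surface: the extremal exterior does not satisfy that package. If a solution has $\mathfrak A_0[u]\ne0$ and the tangential horizon quantities $u$ and $\partial_vu$ decay (tend to $0$ as $v\to\infty$) along $\mathcal H^+$, then the averaged transversal derivative $\int_0^\pi\partial_ru(v,M,\theta)\sin\theta\,d\theta$ does not tend to $0$ as $v\to\infty$. In the decaying radiation energy space at null infinity there is nevertheless no nonzero smooth (axisymmetric) stationary zero-frequency state satisfying both future-horizon regularity and decay at infinity.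
   Context: With $\Delta=(r-M)^2$ and $\rho^2=r^2+a^2\cos^2\theta$, $$g_{M,a,Q}=-\frac{\Delta}{\rho^2}(dt-a\sin^2\theta\,d\phi)^2+\frac{\sin^2\theta}{\rho^2}((r^2+a^2)d\phi-a\,dt)^2+\frac{\rho^2}{\Delta}dr^2+\rho^2d\theta^2 .$$ Derivatives in the charge are in ingoing coordinates $(v,r,\theta,\phi_{\rm in})$, $v=t+r_*$, $\phi_{\rm in}=\phi+\int^r\frac a{\Delta(s)}ds$, $\frac{dr_*}{dr}=\frac{r^2+a^2}{\Delta}$, in which the metric extends smoothly across $r=M$. Future-horizon regular means smooth up to $r=M$ (and at the poles) in these coordinates. Decay along $\mathcal H^+$ is understood uniformly in $\theta$. The subextremal (nondegenerate) black-hole package is a list of nine conditions on a stationary axisymmetric exterior, including: (BH1) each horizon endpoint is a simple root of the radial polynomial $\Delta$ and has positive surface gravity, and the coefficients of $\Box_g$ extend smoothly to the future horizon; (BH4) a finite-time red-shift/local-energy estimate, nondegenerate at the horizon (i.e. controlling all first derivatives including the transversal one), $\sup_{[0,T]}\|U\|^2_{\mathcal E^s}+\|U\|^2_{LE^s([0,T])}\le C_s(\|U(0)\|^2_{\mathcal E^s}+\|\Box_gu\|^2_{LE^{s,*}([0,T])}+\|\chi_{\rm c}U\|^2_{L^2([0,T];H^s_{\rm loc}\times H^{s-1}_{\rm loc})})$ with $C_s$ independent of $T$ and $\chi_{\rm c}$ a compactly supported cutoff. (The remaining conditions concern boundary conditions, generator, mode stability, high-frequency bounds, limiting absorption, zero-frequency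 expansion and cutoffs.) Surface gravity of the Kerr-Newman horizon: $\kappa_+=\frac{r_+-r_-}{2(r_+^2+a^2)}$, $r_\pm=M\pm\sqrt{M^2-a^2-Q^2}$. A stationary zero-frequency state is a time-independent solution of $\Box_gu=0$. The decaying radiation energy space consists of axisymmetric data on a hypersurface crossing the horizon and reaching spatial infinity, in the closure of smooth decaying data under a norm with square equivalent to $\int(|\nabla u_0|^2+|u_1|^2+r^{-2}|u_0|^2)$; nonzero constants are excluded. *)

theory Defs
  imports "HOL-Analysis.Analysis" "HOL-Computational_Algebra.Polynomial"
begin

section \<open>Partial derivatives and smoothness\<close>

definition pd :: "'a::euclidean_space \<Rightarrow> ('a \<Rightarrow> real) \<Rightarrow> 'a \<Rightarrow> real" where
  "pd b f x = frechet_derivative f (at x) b"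

fun pds :: "'a::euclidean_space list \<Rightarrow> ('a \<Rightarrow> real) \<Rightarrow> 'a \<Rightarrow> real" where
  "pds [] f = f"
| "pds (b # bs) f = pd b (pds bs f)"

definition smooth_on :: "'a::euclidean_space set \<Rightarrow> ('a \<Rightarrow> real) \<Rightarrow> bool" where
  "smooth_on W f \<longleftrightarrow>
     open W \<and> (\<forall>bs. set bs \<subseteq> Basis \<longrightarrow> (\<forall>x\<in>W. pds bs f differentiable (at x)))"

text \<open>Smoothness up to the boundary of a (closed) region: the function is the restriction of a smooth
  function on an open neighbourhood. For the regions below (closures of open sets) the derivatives
  at boundary points do not depend on the extension.\<close>

definition smooth_up_to :: "'a::euclidean_space set \<Rightarrow> ('a \<Rightarrow> real) \<Rightarrow> bool" where
  "smooth_up_to D f \<longleftrightarrow> (\<exists>W. D \<subseteq> W \<and> smooth_on W f)"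

section \<open>The Kerr--Newman metric in Boyer--Lindquist coordinates\<close>

definition Delta_poly :: "real \<Rightarrow> real \<Rightarrow> real \<Rightarrow> real poly" where
  "Delta_poly M a Q = [:a\<^sup>2 + Q\<^sup>2, - 2 * M, 1:]"

definition Delta :: "real \<Rightarrow> real \<Rightarrow> real \<Rightarrow> real \<Rightarrow> real" where
  "Delta M a Q r = poly (Delta_poly M a Q) r"

lemma Delta_extremal:
  assumes "a\<^sup>2 + Q\<^sup>2 = M\<^sup>2"
  shows "Delta M a Q r = (r - M)\<^sup>2"
  using assms by (simp add: Delta_def Delta_poly_def power2_eq_square algebra_simps)

definition r_plus :: "real \<Rightarrow> real \<Rightarrow> real \<Rightarrow> real" where
  "r_plus M a Q = M + sqrt (M\<^sup>2 - a\<^sup>2 - Q\<^sup>2)"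

definition r_minus :: "real \<Rightarrow> real \<Rightarrow> real \<Rightarrow> real" where
  "r_minus M a Q = M - sqrt (M\<^sup>2 - a\<^sup>2 - Q\<^sup>2)"

lemma r_plus_extremal:
  assumes "a\<^sup>2 + Q\<^sup>2 = M\<^sup>2"
  shows "r_plus M a Q = M"
  using assms by (simp add: r_plus_def flip: assms)

definition surface_gravity :: "real \<Rightarrow> real \<Rightarrow> real \<Rightarrow> real" where
  "surface_gravity M a Q =
     (r_plus M a Q - r_minus M a Q) / (2 * ((r_plus M a Q)\<^sup>2 + a\<^sup>2))"

definition rho2 :: "real \<Rightarrow> real \<Rightarrow> real \<Rightarrow> real" where
  "rho2 a r \<theta> = r\<^sup>2 + a\<^sup>2 * (cos \<theta>)\<^sup>2"

text \<open>A point of the chart is \<open>q = (t, r, \<theta>, \<phi>)\<close>; covectors are given by their components with respect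
  to \<open>dt, dr, d\<theta>, d\<phi>\<close>.\<close>

definition metric :: "real \<Rightarrow> real \<Rightarrow> real \<Rightarrow> real^4 \<Rightarrow> real^4^4" where
  "metric M a Q q =
    (let r = q $ 2; \<theta> = q $ 3;
         e0 = (vector [1, 0, 0, - a * (sin \<theta>)\<^sup>2] :: real^4);
         e1 = (vector [0, 1, 0, 0] :: real^4);
         e2 = (vector [0, 0, 1, 0] :: real^4);
         e3 = (vector [- a, 0, 0, r\<^sup>2 + a\<^sup>2] :: real^4)
     in \<chi> i j. - (Delta M a Q r / rho2 a r \<theta>) * e0 $ i * e0 $ j
             + ((sin \<theta>)\<^sup>2 / rho2 a r \<theta>) * e3 $ i * e3 $ j
             + (rho2 a r \<theta> / Delta M a Q r) * e1 $ i * e1 $ j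
             + rho2 a r \<theta> * e2 $ i * e2 $ j)"

text \<open>The Laplace--Beltrami operator of a metric given in coordinates.\<close>

definition box_op :: "(real^'n \<Rightarrow> real^'n^'n) \<Rightarrow> (real^'n \<Rightarrow> real) \<Rightarrow> real^'n \<Rightarrow> real" where
  "box_op G f x =
     (1 / sqrt \<bar>det (G x)\<bar>) *
     (\<Sum>i\<in>UNIV. pd (axis i 1)
        (\<lambda>y. sqrt \<bar>det (G y)\<bar> * (\<Sum>j\<in>UNIV. matrix_inv (G y) $ i $ j * pd (axis j 1) f y)) x)"

definition chart :: "real \<Rightarrow> real \<Rightarrow> real \<Rightarrow> (real^4) set" where
  "chart M a Q = {q. r_plus M a Q < q $ 2 \<and> 0 < q $ 3 \<and> q $ 3 < pi}"

section \<open>Ingoing coordinates\<close>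

text \<open>The integration constants in \<open>r\<^sub>*\<close> and in the azimuthal shift are fixed by letting both vanish
  at \<open>r = r\<^sub>+ + 1\<close>.\<close>

definition tortoise :: "real \<Rightarrow> real \<Rightarrow> real \<Rightarrow> real \<Rightarrow> real" where
  "tortoise M a Q r =
     (LBINT s=ereal (r_plus M a Q + 1)..ereal r. (s\<^sup>2 + a\<^sup>2) / Delta M a Q s)"

definition azimuth_shift :: "real \<Rightarrow> real \<Rightarrow> real \<Rightarrow> real \<Rightarrow> real" where
  "azimuth_shift M a Q r =
     (LBINT s=ereal (r_plus M a Q + 1)..ereal r. a / Delta M a Q s)"

text \<open>The spherical coordinates \<open>(r, \<theta>, \<phi>\<^sub>i\<^sub>n)\<close> are realised by the Cartesian point
  \<open>x = r (sin \<theta> cos \<phi>\<^sub>i\<^sub>n, sin \<theta> sin \<phi>\<^sub>i\<^sub>n, cos \<theta>)\<close>, so that \<open>r = norm x\<close>. A spacetime point is a pair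
  \<open>(v, x)\<close>, and smoothness in \<open>(v, x)\<close> includes smoothness at the poles.\<close>

type_synonym spacetime = "real \<times> (real^3)"

definition sph :: "real \<Rightarrow> real \<Rightarrow> real \<Rightarrow> real^3" where
  "sph r \<theta> \<phi> = vector [r * sin \<theta> * cos \<phi>, r * sin \<theta> * sin \<phi>, r * cos \<theta>]"

definition to_ingoing :: "real \<Rightarrow> real \<Rightarrow> real \<Rightarrow> real^4 \<Rightarrow> spacetime" where
  "to_ingoing M a Q q =
     (q $ 1 + tortoise M a Q (q $ 2), sph (q $ 2) (q $ 3) (q $ 4 + azimuth_shift M a Q (q $ 2)))"

definition in_coords :: "(spacetime \<Rightarrow> real) \<Rightarrow> real \<Rightarrow> real \<Rightarrow> real \<Rightarrow> real \<Rightarrow> real" where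
  "in_coords u v r \<theta> \<phi> = u (v, sph r \<theta> \<phi>)"

definition exterior :: "real \<Rightarrow> real \<Rightarrow> real \<Rightarrow> (real^3) set" where
  "exterior M a Q = {x. r_plus M a Q \<le> norm x}"

text \<open>The axis is missing from the chart; since all functions concerned are smooth in \<open>(v, x)\<close>, an
  equation on the chart determines it on the axis by continuity.\<close>

definition solves_box ::
  "real \<Rightarrow> real \<Rightarrow> real \<Rightarrow> spacetime set \<Rightarrow> (spacetime \<Rightarrow> real) \<Rightarrow> (spacetime \<Rightarrow> real) \<Rightarrow> bool" where
  "solves_box M a Q D u F \<longleftrightarrow>
     (\<forall>q\<in>chart M a Q. to_ingoing M a Q q \<in> D \<longrightarrow>
        box_op (metric M a Q) (u \<circ> to_ingoing M a Q) q = F (to_ingoing M a Q q))"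

text \<open>The Killing field \<open>\<partial>\<^sub>\<phi> = x\<^sub>1 \<partial>\<^sub>2 - x\<^sub>2 \<partial>\<^sub>1\<close>.\<close>

definition rot :: "real^3 \<Rightarrow> real^3" where
  "rot x = vector [- x $ 2, x $ 1, 0]"

definition axisymmetric :: "spacetime set \<Rightarrow> (spacetime \<Rightarrow> real) \<Rightarrow> bool" where
  "axisymmetric D u \<longleftrightarrow> (\<forall>(v, x)\<in>D. pd (0, rot x) u (v, x) = 0)"

section \<open>Spacelike slices and regular solutions\<close>

text \<open>\<open>\<tau> = v - r\<close> is the Kerr--Schild time. Its level sets are spacelike, cross the future horizon and
  reach spatial infinity. Each is parametrised by \<open>x\<close>; \<open>\<partial>\<^sub>\<tau>\<close> at fixed \<open>x\<close> is \<open>\<partial>\<^sub>v\<close>.\<close>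

definition slice :: "real \<Rightarrow> (spacetime \<Rightarrow> real) \<Rightarrow> real^3 \<Rightarrow> real" where
  "slice \<tau> u x = u (\<tau> + norm x, x)"

definition slice_dt :: "real \<Rightarrow> (spacetime \<Rightarrow> real) \<Rightarrow> real^3 \<Rightarrow> real" where
  "slice_dt \<tau> u = slice \<tau> (pd (1, 0) u)"

definition future :: "real \<Rightarrow> real \<Rightarrow> real \<Rightarrow> real \<Rightarrow> spacetime set" where
  "future M a Q \<tau>0 = {(v, x). x \<in> exterior M a Q \<and> \<tau>0 \<le> v - norm x}"

definition slab :: "real \<Rightarrow> real \<Rightarrow> real \<Rightarrow> real \<Rightarrow> spacetime set" where
  "slab M a Q T = {(v, x). x \<in> exterior M a Q \<and> 0 \<le> v - norm x \<and> v - norm x \<le> T}"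

text \<open>Axisymmetric solutions launched by smooth horizon-regular data on \<open>\<tau> = \<tau>0\<close>.\<close>

definition regular_solution ::
  "real \<Rightarrow> real \<Rightarrow> real \<Rightarrow> real \<Rightarrow> (spacetime \<Rightarrow> real) \<Rightarrow> bool" where
  "regular_solution M a Q \<tau>0 u \<longleftrightarrow>
     smooth_up_to (future M a Q \<tau>0) u \<and>
     solves_box M a Q (future M a Q \<tau>0) u (\<lambda>_. 0) \<and>
     axisymmetric (future M a Q \<tau>0) u"

text \<open>The horizon charge. The integrand is evaluated at \<open>\<phi>\<^sub>i\<^sub>n = 0\<close>; it does not depend on \<open>\<phi>\<^sub>i\<^sub>n\<close> for
  axisymmetric \<open>u\<close>.\<close>

definition charge :: "real \<Rightarrow> real \<Rightarrow> (spacetime \<Rightarrow> real) \<Rightarrow> real \<Rightarrow> real" where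
  "charge M a u v =
     integral {0..pi} (\<lambda>\<theta>.
       (2 * (M\<^sup>2 + a\<^sup>2) * deriv (\<lambda>r. in_coords u v r \<theta> 0) M
        + 2 * M * in_coords u v M \<theta> 0
        + a\<^sup>2 * (sin \<theta>)\<^sup>2 * deriv (\<lambda>w. in_coords u w M \<theta> 0) v) * sin \<theta>)"

section \<open>Norms\<close>

text \<open>Squares of norms, as extended nonnegative reals. Derivatives are indexed by lists of Cartesian
  basis vectors, i.e. ordered multi-indices.\<close>

definition multi :: "nat \<Rightarrow> 'a::euclidean_space list set" where
  "multi k = {bs. set bs \<subseteq> Basis \<and> length bs \<le> k}"

definition sobolev_sq :: "(real^3) set \<Rightarrow> nat \<Rightarrow> (real^3 \<Rightarrow> real) \<Rightarrow> ennreal" where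
  "sobolev_sq S k f = (\<Sum>bs\<in>multi k. \<integral>\<^sup>+x\<in>S. ennreal ((pds bs f x)\<^sup>2) \<partial>lborel)"

text \<open>For \<open>s = 1\<close> this is \<open>\<integral> (|\<nabla>u\<^sub>0|\<^sup>2 + |u\<^sub>1|\<^sup>2 + r\<^sup>-\<^sup>2 |u\<^sub>0|\<^sup>2)\<close>; it is meant for \<open>s \<ge> 1\<close>.\<close>

definition energy_sq ::
  "(real^3) set \<Rightarrow> nat \<Rightarrow> (real^3 \<Rightarrow> real) \<Rightarrow> (real^3 \<Rightarrow> real) \<Rightarrow> ennreal" where
  "energy_sq S s u0 u1 =
     (\<Sum>bs\<in>multi (s - 1).
        \<integral>\<^sup>+x\<in>S. ennreal ((\<Sum>b\<in>Basis. (pds (b # bs) u0 x)\<^sup>2) + (pds bs u1 x)\<^sup>2) \<partial>lborel)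
     + (\<integral>\<^sup>+x\<in>S. ennreal ((u0 x)\<^sup>2 / (norm x)\<^sup>2) \<partial>lborel)"

text \<open>The dyadic local energy norm \<open>LE\<^sup>s\<close> and its dual norm \<open>LE\<^sup>s\<^sup>,\<^sup>*\<close>. No weight degenerates at the
  horizon, so all first derivatives, including the transversal one, are controlled there.\<close>

definition annulus :: "nat \<Rightarrow> (real^3) set" where
  "annulus j = {x. (j = 0 \<or> 2 ^ j \<le> norm x) \<and> norm x < 2 ^ Suc j}"

definition ennsqrt :: "ennreal \<Rightarrow> ennreal" where
  "ennsqrt x = (if x = top then top else ennreal (sqrt (enn2real x)))"

definition LE_sq :: "(real^3) set \<Rightarrow> nat \<Rightarrow> real \<Rightarrow> (spacetime \<Rightarrow> real) \<Rightarrow> ennreal" where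
  "LE_sq S s T u =
     (SUP j. ennreal (1 / 2 ^ j) *
        (\<integral>\<^sup>+\<tau>\<in>{0..T}. energy_sq (S \<inter> annulus j) s (slice \<tau> u) (slice_dt \<tau> u) \<partial>lborel))"

definition LE_star_sq :: "(real^3) set \<Rightarrow> nat \<Rightarrow> real \<Rightarrow> (spacetime \<Rightarrow> real) \<Rightarrow> ennreal" where
  "LE_star_sq S s T F =
     (\<Sum>j. ennsqrt (ennreal (2 ^ j) *
        (\<integral>\<^sup>+\<tau>\<in>{0..T}. sobolev_sq (S \<inter> annulus j) (s - 1) (slice \<tau> F) \<partial>lborel)))\<^sup>2"

definition cutoff :: "(real^3 \<Rightarrow> real) \<Rightarrow> bool" where
  "cutoff \<eta> \<longleftrightarrow> smooth_on UNIV \<eta> \<and> compact (closure {x. \<eta> x \<noteq> 0}) \<and> (\<forall>x. 0 \<le> \<eta> x \<and> \<eta> x \<le> 1)"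

definition cutoff_sq ::
  "(real^3) set \<Rightarrow> nat \<Rightarrow> real \<Rightarrow> (real^3 \<Rightarrow> real) \<Rightarrow> (spacetime \<Rightarrow> real) \<Rightarrow> ennreal" where
  "cutoff_sq S s T \<eta> u =
     (\<integral>\<^sup>+\<tau>\<in>{0..T}. sobolev_sq S s (\<lambda>x. \<eta> x * slice \<tau> u x)
                 + sobolev_sq S (s - 1) (\<lambda>x. \<eta> x * slice_dt \<tau> u x) \<partial>lborel)"

section \<open>The black-hole package\<close>

text \<open>The exterior \<open>r > r\<^sub>+\<close> has the single horizon endpoint \<open>r\<^sub>+\<close>. The last conjunct says that the
  coefficients of \<open>\<box>\<^sub>g\<close> in the ingoing Cartesian coordinates extend smoothly to \<open>r = r\<^sub>+\<close>.\<close>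

definition BH1 :: "real \<Rightarrow> real \<Rightarrow> real \<Rightarrow> bool" where
  "BH1 M a Q \<longleftrightarrow>
     order (r_plus M a Q) (Delta_poly M a Q) = 1 \<and>
     surface_gravity M a Q > 0 \<and>
     (\<exists>(A :: spacetime \<Rightarrow> spacetime \<Rightarrow> spacetime \<Rightarrow> real) (B :: spacetime \<Rightarrow> spacetime \<Rightarrow> real).
        (\<forall>b\<in>Basis. smooth_up_to (UNIV \<times> exterior M a Q) (B b) \<and>
           (\<forall>b'\<in>Basis. smooth_up_to (UNIV \<times> exterior M a Q) (A b b'))) \<and>
        (\<forall>u. smooth_on (UNIV \<times> {x. r_plus M a Q < norm x}) u \<longrightarrow>
           solves_box M a Q (UNIV \<times> {x. r_plus M a Q < norm x}) u
             (\<lambda>p. (\<Sum>b\<in>Basis. \<Sum>b'\<in>Basis. A b b' p * pds [b, b'] u p)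
                + (\<Sum>b\<in>Basis. B b p * pd b u p))))"

definition BH4 :: "real \<Rightarrow> real \<Rightarrow> real \<Rightarrow> bool" where
  "BH4 M a Q \<longleftrightarrow>
     (\<exists>\<eta>. cutoff \<eta> \<and>
       (\<forall>s\<ge>1. \<exists>C>0. \<forall>T>0. \<forall>u F.
          smooth_up_to (slab M a Q T) u \<and> smooth_up_to (slab M a Q T) F \<and>
          solves_box M a Q (slab M a Q T) u F \<longrightarrow>
          (let S = exterior M a Q in
             (SUP \<tau>\<in>{0..T}. energy_sq S s (slice \<tau> u) (slice_dt \<tau> u)) + LE_sq S s T u
             \<le> ennreal C * (energy_sq S s (slice 0 u) (slice_dt 0 u)
                             + LE_star_sq S s T F + cutoff_sq S s T \<eta> u))))"

text \<open>The package consists of nine conditions, numbered 1 to 9. The seven that play no role here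
  (boundary conditions, generator, mode stability, high-frequency bounds, limiting absorption,
  zero-frequency expansion, cutoffs) enter as arbitrary predicates \<open>other i\<close> of the parameters.\<close>

definition bh_package ::
  "(nat \<Rightarrow> real \<Rightarrow> real \<Rightarrow> real \<Rightarrow> bool) \<Rightarrow> real \<Rightarrow> real \<Rightarrow> real \<Rightarrow> bool" where
  "bh_package other M a Q \<longleftrightarrow>
     BH1 M a Q \<and> BH4 M a Q \<and> (\<forall>i\<in>{2, 3, 5, 6, 7, 8, 9}. other i M a Q)"

section \<open>Stationary states and the decaying radiation energy space\<close>

definition stationary_state :: "real \<Rightarrow> real \<Rightarrow> real \<Rightarrow> (spacetime \<Rightarrow> real) \<Rightarrow> bool" where
  "stationary_state M a Q u \<longleftrightarrow>
     smooth_up_to (UNIV \<times> exterior M a Q) u \<and>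
     solves_box M a Q (UNIV \<times> exterior M a Q) u (\<lambda>_. 0) \<and>
     axisymmetric (UNIV \<times> exterior M a Q) u \<and>
     (\<forall>v v'. \<forall>x\<in>exterior M a Q. u (v, x) = u (v', x))"

definition decaying_data ::
  "real \<Rightarrow> real \<Rightarrow> real \<Rightarrow> (real^3 \<Rightarrow> real) \<Rightarrow> (real^3 \<Rightarrow> real) \<Rightarrow> bool" where
  "decaying_data M a Q f0 f1 \<longleftrightarrow>
     smooth_up_to (exterior M a Q) f0 \<and> smooth_up_to (exterior M a Q) f1 \<and>
     (\<forall>x\<in>exterior M a Q. pd (rot x) f0 x = 0 \<and> pd (rot x) f1 x = 0) \<and>
     (f0 \<longlongrightarrow> 0) at_infinity \<and> (f1 \<longlongrightarrow> 0) at_infinity \<and>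
     energy_sq (exterior M a Q) 1 f0 f1 < top"

text \<open>The smooth elements of the closure of the decaying data in the energy norm. The weight
  \<open>r\<^sup>-\<^sup>2\<close> excludes nonzero constants. The flat volume element in \<open>x\<close> replaces the induced one,
  which gives an equivalent norm.\<close>

definition radiation_space ::
  "real \<Rightarrow> real \<Rightarrow> real \<Rightarrow> (real^3 \<Rightarrow> real) \<Rightarrow> (real^3 \<Rightarrow> real) \<Rightarrow> bool" where
  "radiation_space M a Q u0 u1 \<longleftrightarrow>
     smooth_up_to (exterior M a Q) u0 \<and> smooth_up_to (exterior M a Q) u1 \<and>
     (\<exists>f0 f1. (\<forall>n::nat. decaying_data M a Q (f0 n) (f1 n)) \<and>
        (\<lambda>n. energy_sq (exterior M a Q) 1 (\<lambda>x. u0 x - f0 n x) (\<lambda>x. u1 x - f1 n x)) \<longlonglongrightarrow> 0)"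

end

(* In ingoing coordinates the axisymmetric wave equation multiplied by rho^2 reads
     d_r (Delta u_r) + 2 (r^2 + a^2) u_vr + 2 r u_v + a^2 sin^2 th u_vv + (1 / sin th) d_th (sin th u_th) = 0.
   At the extremal horizon Delta and Delta' both vanish, so integrating over the sphere kills the angular
   term and leaves the v-derivative of the charge. The subextremal package already fails because the
   surface gravity is 0, and a conserved nonzero charge cannot be carried by decaying tangential
   quantities alone.

   For a stationary u, the mean F r of u^2 over the sphere of radius r satisfies (Delta F')' >= 0; since Delta
   vanishes at the horizon, F is nondecreasing. The weight 1/r^2 in the energy makes F integrable on
   [M, infinity), hence F = 0. *)

theory Submission
  imports Defs
begin


subsection \<open>Calculus of smooth functions\<close>

text \<open>The equation is posed only on the open Boyer-Lindquist chart, where r > M, 0 < \<theta>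
  < pi and the coefficients blow up like 1 / (r - M)^2; the charge lives on r = M, and its integrals
  reach the poles. Passing to ingoing variables turns the radial derivative into d_r + (r^2 + a^2) /
  \<Delta> d_v, and the two terms (r^2 + a^2)^2 / \<Delta> u_vv, one from the time part and one from
  the radial part, cancel. With the factor sin \<theta> kept in front, the other coefficients are
  continuous up to horizon and axis, so continuity carries the equation there. Smoothness up to the
  boundary supplies an open neighbourhood, hence derivatives on the horizon are ordinary two-sided
  ones.

  In the energy argument the weight 1 / r^2 cancels the r^2 of the spherical volume element, so the
  energy controls the integral of F dr itself. If F r0 = c > 0, monotonicity makes this integral at
  least c (R - r0) up to every R. A lower bound suffices here, and it can be read off from a sector
  of the shell.\<close>

lemma has_derivative_pd:
  "f differentiable (at x) \<Longrightarrow> (f has_derivative (\<lambda>h. pd h f x)) (at x)"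
  by (simp add: pd_def frechet_derivative_works[symmetric])

lemma pd_eqI: "(f has_derivative f') (at x) \<Longrightarrow> pd b f x = f' b"
  by (metis frechet_derivative_at pd_def)

text \<open>\<open>frechet_derivative\<close> is a choice depending only on the predicate
  \<open>has_derivative\<close>, which is local; so this holds even at points of
  non-differentiability. It allows rewriting the fluxes inside \<open>box_op\<close> before they are
  known to be differentiable.\<close>

lemma pd_cong:
  assumes "open W" "x \<in> W" "\<And>y. y \<in> W \<Longrightarrow> f y = g y"
  shows "pd b f x = pd b g x"
proof -
  have "(f has_derivative F) (at x) \<longleftrightarrow> (g has_derivative F) (at x)" for F
    using assms has_derivative_transform_within_open[of f F x UNIV W g]
      has_derivative_transform_within_open[of g F x UNIV W f] by (metis)
  then show ?thesis
    by (simp add: pd_def frechet_derivative_def)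
qed

lemma differentiable_cong_open:
  fixes f g :: "'a::euclidean_space \<Rightarrow> real"
  assumes "open W" "x \<in> W" "\<And>y. y \<in> W \<Longrightarrow> f y = g y" "f differentiable (at x)"
  shows "g differentiable (at x)"
  using assms has_derivative_transform_within_open[of f _ x UNIV W g]
  unfolding differentiable_def by metis

lemma pd_along_line:
  fixes f :: "'a::euclidean_space \<Rightarrow> real"
  assumes "f differentiable (at (x + t *\<^sub>R b))"
  shows "((\<lambda>t. f (x + t *\<^sub>R b)) has_real_derivative pd b f (x + t *\<^sub>R b)) (at t within S)"
proof -
  have "((\<lambda>t. f (x + t *\<^sub>R b)) has_derivative (\<lambda>h. pd (h *\<^sub>R b) f (x + t *\<^sub>R b))) (at t within S)"
    by (rule has_derivative_compose[where f="\<lambda>t. x + t *\<^sub>R b" and g=f, OF _ has_derivative_pd[OF assms]])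
       (auto intro!: derivative_eq_intros)
  moreover have "pd (h *\<^sub>R b) f (x + t *\<^sub>R b) = pd b f (x + t *\<^sub>R b) * h" for h
    using linear_frechet_derivative[OF assms] by (simp add: pd_def linear_scale)
  ultimately show ?thesis
    by (simp add: has_field_derivative_def)
qed

lemma pd_expand:
  fixes f :: "'a::euclidean_space \<Rightarrow> real"
  assumes "f differentiable (at x)"
  shows "pd h f x = (\<Sum>i\<in>Basis. pd i f x * (h \<bullet> i))"
proof -
  interpret linear "\<lambda>h. pd h f x"
    using linear_frechet_derivative[OF assms] by (simp add: pd_def[abs_def])
  have "pd h f x = pd (\<Sum>i\<in>Basis. (h \<bullet> i) *\<^sub>R i) f x"
    by (simp add: euclidean_representation)
  also have "\<dots> = (\<Sum>i\<in>Basis. pd i f x * (h \<bullet> i))"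
    by (simp add: sum scale mult.commute)
  finally show ?thesis .
qed

text \<open>The list quantifier in \<open>smooth_on\<close> offers no induction through product and
  chain rule. Here the recursion replaces the function by its first derivatives, so an induction on
  the order with the function arbitrary gives the closure properties.\<close>

primrec diff_upto :: "nat \<Rightarrow> 'a::euclidean_space set \<Rightarrow> ('a \<Rightarrow> real) \<Rightarrow> bool" where
  "diff_upto 0 W f \<longleftrightarrow> (\<forall>x\<in>W. f differentiable (at x))"
| "diff_upto (Suc k) W f \<longleftrightarrow>
     (\<forall>x\<in>W. f differentiable (at x)) \<and> (\<forall>b\<in>Basis. diff_upto k W (pd b f))"

lemma diff_upto_differentiable: "diff_upto k W f \<Longrightarrow> x \<in> W \<Longrightarrow> f differentiable (at x)"
  by (cases k) auto

lemma pds_append: "pds (bs @ cs) f = pds bs (pds cs f)"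
  by (induction bs) auto

lemma diff_upto_iff:
  "diff_upto k W f \<longleftrightarrow>
     (\<forall>bs. set bs \<subseteq> Basis \<and> length bs \<le> k \<longrightarrow> (\<forall>x\<in>W. pds bs f differentiable (at x)))"
proof (induction k arbitrary: f)
  case 0
  then show ?case by auto
next
  case (Suc k)
  show ?case
  proof
    assume L: "diff_upto (Suc k) W f"
    show "\<forall>bs. set bs \<subseteq> Basis \<and> length bs \<le> Suc k \<longrightarrow> (\<forall>x\<in>W. pds bs f differentiable (at x))"
    proof (intro allI impI ballI)
      fix bs :: "'a list" and x
      assume bs: "set bs \<subseteq> Basis \<and> length bs \<le> Suc k" and x: "x \<in> W"
      show "pds bs f differentiable (at x)"
      \<comment> \<open>The last list entry is the derivative that \<open>pds\<close> takes first,
        and this is the one that \<open>diff_upto\<close> peels off.\<close>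
      proof (cases bs rule: rev_cases)
        case Nil
        then show ?thesis using L x by simp
      next
        case (snoc cs b)
        then show ?thesis using L x bs Suc.IH[of "pd b f"] by (auto simp: pds_append)
      qed
    qed
  next
    assume R: "\<forall>bs. set bs \<subseteq> Basis \<and> length bs \<le> Suc k \<longrightarrow> (\<forall>x\<in>W. pds bs f differentiable (at x))"
    have "pds bs (pd b f) differentiable (at x)"
      if "b \<in> Basis" "set bs \<subseteq> Basis" "length bs \<le> k" "x \<in> W" for b bs x
      using R[rule_format, of "bs @ [b]" x] that by (simp add: pds_append)
    then show "diff_upto (Suc k) W f"
      using R[rule_format, of "[]"] Suc.IH by simp
  qed
qed

lemma smooth_on_iff: "smooth_on W f \<longleftrightarrow> open W \<and> (\<forall>k. diff_upto k W f)"
  unfolding smooth_on_def diff_upto_iff by blast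

lemma smooth_on_open: "smooth_on W f \<Longrightarrow> open W"
  by (simp add: smooth_on_def)

lemma smooth_on_differentiable: "smooth_on W f \<Longrightarrow> x \<in> W \<Longrightarrow> f differentiable (at x)"
  by (metis smooth_on_iff diff_upto_differentiable)

lemma smooth_on_pd: "smooth_on W f \<Longrightarrow> b \<in> Basis \<Longrightarrow> smooth_on W (pd b f)"
  unfolding smooth_on_iff by (metis diff_upto.simps(2))

lemma smooth_on_continuous: "smooth_on W f \<Longrightarrow> continuous_on W f"
  by (meson continuous_at_imp_continuous_on differentiable_imp_continuous_within smooth_on_differentiable)

lemma diff_upto_cong:
  assumes "open W" "\<And>y. y \<in> W \<Longrightarrow> f y = g y" "diff_upto k W f"
  shows "diff_upto k W g"
  using assms(2,3)
proof (induction k arbitrary: f g)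
  case 0
  have "g differentiable (at x)" if "x \<in> W" for x
    by (rule differentiable_cong_open[OF assms(1) that, of f]) (use 0 that in simp_all)
  then show ?case by simp
next
  case (Suc k)
  have "diff_upto k W (pd b g)" if "b \<in> Basis" for b
  proof (rule Suc.IH)
    show "diff_upto k W (pd b f)" using Suc.prems that by simp
    show "pd b f y = pd b g y" if "y \<in> W" for y
      by (rule pd_cong[OF assms(1) that]) (rule Suc.prems(1))
  qed
  moreover have "g differentiable (at x)" if "x \<in> W" for x
    by (rule differentiable_cong_open[OF assms(1) that, of f]) (use Suc.prems that in simp_all)
  ultimately show ?case by simp
qed

lemma diff_upto_le: "diff_upto (Suc k) W f \<Longrightarrow> diff_upto k W f"
  by (induction k arbitrary: f) auto

lemma diff_upto_const: "diff_upto k W (\<lambda>_. c)"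
proof (induction k arbitrary: c)
  case (Suc k)
  have "pd b (\<lambda>_::'a. c) = (\<lambda>_. 0)" for b
    by (auto simp: fun_eq_iff intro!: pd_eqI[of _ "\<lambda>_. 0", THEN trans])
  then show ?case using Suc by simp
qed auto

lemma diff_upto_add:
  assumes "open W" "diff_upto k W f" "diff_upto k W g"
  shows "diff_upto k W (\<lambda>x. f x + g x)"
  using assms(2,3)
proof (induction k arbitrary: f g)
  case (Suc k)
  have "diff_upto k W (pd b (\<lambda>x. f x + g x))" if "b \<in> Basis" for b
  proof (rule diff_upto_cong[OF assms(1)])
    show "diff_upto k W (\<lambda>x. pd b f x + pd b g x)"
      using Suc that by simp
    show "pd b f y + pd b g y = pd b (\<lambda>x. f x + g x) y" if "y \<in> W" for y
      by (rule pd_eqI[symmetric])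
         (use Suc.prems that in \<open>auto intro!: derivative_eq_intros has_derivative_pd\<close>)
  qed
  then show ?case using Suc.prems by auto
qed auto

lemma diff_upto_mult:
  assumes "open W" "diff_upto k W f" "diff_upto k W g"
  shows "diff_upto k W (\<lambda>x. f x * g x)"
  using assms(2,3)
proof (induction k arbitrary: f g)
  case (Suc k)
  have "diff_upto k W (pd b (\<lambda>x. f x * g x))" if "b \<in> Basis" for b
  proof (rule diff_upto_cong[OF assms(1)])
    show "diff_upto k W (\<lambda>x. f x * pd b g x + pd b f x * g x)"
      using Suc that diff_upto_le[of k] by (intro diff_upto_add Suc.IH assms(1)) auto
    show "f y * pd b g y + pd b f y * g y = pd b (\<lambda>x. f x * g x) y" if "y \<in> W" for y
      by (rule pd_eqI[symmetric])
         (use Suc.prems that in \<open>auto intro!: derivative_eq_intros has_derivative_pd\<close>)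
  qed
  then show ?case using Suc.prems by auto
qed auto

lemma diff_upto_sum:
  assumes "open W" "finite I" "\<And>i. i \<in> I \<Longrightarrow> diff_upto k W (f i)"
  shows "diff_upto k W (\<lambda>x. \<Sum>i\<in>I. f i x)"
  using assms(2,3) by (induction I) (auto simp: diff_upto_const intro!: diff_upto_add assms(1))

lemma differentiable_componentwise:
  fixes g :: "'b::euclidean_space \<Rightarrow> 'a::euclidean_space"
  assumes "\<And>i. i \<in> Basis \<Longrightarrow> (\<lambda>y. g y \<bullet> i) differentiable (at y)"
  shows "(g has_derivative (\<lambda>h. \<Sum>i\<in>Basis. pd h (\<lambda>y. g y \<bullet> i) y *\<^sub>R i)) (at y)"
  by (subst has_derivative_componentwise_within)
     (auto simp: inner_sum_left inner_Basis if_distrib[of "(*) _"] cong: if_cong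
        intro!: has_derivative_pd assms)

lemma pd_compose:
  fixes g :: "'b::euclidean_space \<Rightarrow> 'a::euclidean_space"
  assumes "f differentiable (at (g y))" "\<And>i. i \<in> Basis \<Longrightarrow> (\<lambda>y. g y \<bullet> i) differentiable (at y)"
  shows "((\<lambda>y. f (g y)) has_derivative (\<lambda>b. \<Sum>i\<in>Basis. pd i f (g y) * pd b (\<lambda>y. g y \<bullet> i) y)) (at y)"
proof -
  have "((\<lambda>y. f (g y)) has_derivative (\<lambda>b. pd (\<Sum>i\<in>Basis. pd b (\<lambda>y. g y \<bullet> i) y *\<^sub>R i) f (g y))) (at y)"
    by (rule has_derivative_compose[OF differentiable_componentwise has_derivative_pd]) (use assms in auto)
  then show ?thesis
    by (subst (asm) pd_expand[OF assms(1)])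
       (simp add: inner_sum_left inner_Basis if_distrib[of "(*) _"] cong: if_cong)
qed

text \<open>The chain rule writes a first derivative as a sum of products of \<open>pd i f\<close>
  composed with \<open>g\<close> and derivatives of the components of \<open>g\<close>. The
  induction hypothesis covers the former because it keeps \<open>g\<close> fixed and leaves
  \<open>f\<close> arbitrary.\<close>

lemma diff_upto_compose:
  fixes g :: "'b::euclidean_space \<Rightarrow> 'a::euclidean_space"
  assumes "open W" "open V" "g ` V \<subseteq> W"
    and g: "\<And>i. i \<in> Basis \<Longrightarrow> diff_upto k V (\<lambda>y. g y \<bullet> i)" and "diff_upto k W f"
  shows "diff_upto k V (\<lambda>y. f (g y))"
  using assms(4,5)
proof (induction k arbitrary: f)
  case 0
  have "(\<lambda>y. f (g y)) differentiable (at y)" if "y \<in> V" for y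
    by (rule differentiableI[OF pd_compose[of f g y]]) (use 0 assms(3) that in auto)
  then show ?case by simp
next
  case (Suc k)
  have D: "((\<lambda>y. f (g y)) has_derivative (\<lambda>b. \<Sum>i\<in>Basis. pd i f (g y) * pd b (\<lambda>y. g y \<bullet> i) y)) (at y)"
    if "y \<in> V" for y
    using pd_compose[of f g y] assms(3) Suc.prems that by auto
  have "diff_upto k V (pd b (\<lambda>y. f (g y)))" if b: "b \<in> Basis" for b
  proof (rule diff_upto_cong[OF assms(2)])
    have "diff_upto k V (\<lambda>y. pd i f (g y))" "diff_upto k V (pd b (\<lambda>y. g y \<bullet> i))"
      if "i \<in> Basis" for i
    proof -
      show "diff_upto k V (\<lambda>y. pd i f (g y))"
      proof (rule Suc.IH)
        show "diff_upto k V (\<lambda>y. g y \<bullet> j)" if "j \<in> Basis" for j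
          using Suc.prems(1)[OF that] by (rule diff_upto_le)
      qed (use Suc.prems that in simp)
      show "diff_upto k V (pd b (\<lambda>y. g y \<bullet> i))"
        using Suc.prems(1)[OF that] b by simp
    qed
    then show "diff_upto k V (\<lambda>y. \<Sum>i\<in>Basis. pd i f (g y) * pd b (\<lambda>y. g y \<bullet> i) y)"
      by (intro diff_upto_sum diff_upto_mult assms(2) finite_Basis)
    show "(\<Sum>i\<in>Basis. pd i f (g y) * pd b (\<lambda>y. g y \<bullet> i) y) = pd b (\<lambda>y. f (g y)) y"
      if "y \<in> V" for y
      using pd_eqI[OF D[OF that], of b] by simp
  qed
  moreover have "(\<lambda>y. f (g y)) differentiable (at y)" if "y \<in> V" for y
    using D[OF that] by (rule differentiableI)
  ultimately show ?case by simp
qed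

lemma smooth_on_const: "open W \<Longrightarrow> smooth_on W (\<lambda>_. c)"
  by (simp add: smooth_on_iff diff_upto_const)

lemma smooth_on_mult: "smooth_on W f \<Longrightarrow> smooth_on W g \<Longrightarrow> smooth_on W (\<lambda>x. f x * g x)"
  by (simp add: smooth_on_iff diff_upto_mult)

lemma smooth_on_compose:
  assumes "smooth_on W f" "open V" "g ` V \<subseteq> W" "\<And>i. i \<in> Basis \<Longrightarrow> smooth_on V (\<lambda>y. g y \<bullet> i)"
  shows "smooth_on V (\<lambda>y. f (g y))"
  using assms diff_upto_compose[of W V g _ f] by (simp add: smooth_on_iff)

lemma smooth_on_linear:
  assumes "open W" "bounded_linear f"
  shows "smooth_on W f"
proof -
  have "(f has_derivative f) (at x)" for x
    using assms(2) by (rule bounded_linear_imp_has_derivative)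
  then have "pd b f = (\<lambda>_. f b)" "f differentiable (at x)" for b x
    by (auto simp: fun_eq_iff differentiable_def intro: pd_eqI)
  then have "diff_upto k W f" for k
    by (cases k) (simp_all add: diff_upto_const)
  then show ?thesis using assms by (simp add: smooth_on_iff)
qed

text \<open>The span of sine and cosine is closed under differentiation, so one induction with free
  coefficients serves both functions.\<close>

lemma diff_upto_sin_cos: "diff_upto k UNIV (\<lambda>x. c * sin x + d * cos x)"
proof (induction k arbitrary: c d)
  case 0
  have "(\<lambda>x. c * sin x + d * cos x) differentiable (at x)" for x
    by (rule differentiableI) (auto intro!: derivative_eq_intros)
  then show ?case by simp
next
  case (Suc k)
  have D: "((\<lambda>x. c * sin x + d * cos x) has_derivative (\<lambda>h. (- d * sin x + c * cos x) * h)) (at x)" for x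
    by (auto intro!: derivative_eq_intros simp: algebra_simps)
  have "pd b (\<lambda>x. c * sin x + d * cos x) = (\<lambda>x. - d * sin x + c * cos x)" if "b \<in> Basis" for b
    by (rule ext) (use that in \<open>simp add: pd_eqI[OF D]\<close>)
  moreover have "(\<lambda>x. c * sin x + d * cos x) differentiable (at x)" for x
    by (rule differentiableI) (auto intro!: derivative_eq_intros)
  ultimately show ?case using Suc[of "- d" c] by simp
qed

lemma smooth_on_sin: "smooth_on UNIV (sin :: real \<Rightarrow> real)"
  and smooth_on_cos: "smooth_on UNIV (cos :: real \<Rightarrow> real)"
  using diff_upto_sin_cos[of _ 1 0] diff_upto_sin_cos[of _ 0 1] by (simp_all add: smooth_on_iff)

text \<open>Symmetry of second derivatives by integration: the increment of \<open>f\<close> in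
  direction \<open>b\<close> is the integral of \<open>pd b f\<close>. Differentiating it in
  direction \<open>a\<close> under the integral sign, then in the upper limit, yields the two
  orders.\<close>

lemma pd_commute:
  fixes f :: "'a::euclidean_space \<Rightarrow> real"
  assumes f: "smooth_on W f" and x: "x \<in> W" and ab: "a \<in> Basis" "b \<in> Basis"
  shows "pd a (pd b f) x = pd b (pd a f) x"
proof -
  obtain e where e: "e > 0" "ball x e \<subseteq> W"
    using f x smooth_on_open openE by metis
  \<comment> \<open>A displacement by at most \<open>d\<close> in each of two unit directions has
    length at most 2 e / 3, which stays inside the ball.\<close>
  define d where "d = e / 3"
  have d: "d > 0" using e by (simp add: d_def)
  have in_W: "x + s *\<^sub>R a + t *\<^sub>R b \<in> W" if "\<bar>s\<bar> \<le> d" "\<bar>t\<bar> \<le> d" for s t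
  proof -
    have "norm (s *\<^sub>R a + t *\<^sub>R b) \<le> \<bar>s\<bar> + \<bar>t\<bar>"
      using ab norm_triangle_ineq[of "s *\<^sub>R a" "t *\<^sub>R b"] by simp
    also have "\<dots> < e" using that e by (simp add: d_def)
    finally have "x + s *\<^sub>R a + t *\<^sub>R b \<in> ball x e"
      by (metis add.assoc add_diff_cancel_left' dist_commute dist_norm mem_ball)
    then show ?thesis using e by blast
  qed
  define G where "G s t = pd a (pd b f) (x + s *\<^sub>R a + t *\<^sub>R b)" for s t
  have smb: "smooth_on W (pd b f)" and sma: "smooth_on W (pd a f)"
    and smab: "smooth_on W (pd a (pd b f))"
    using f ab by (auto intro: smooth_on_pd)
  have c1: "continuous_on ({-d..d} \<times> {-d..d}) (\<lambda>(s,t). G s t)"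
    unfolding G_def case_prod_unfold
    by (rule continuous_on_compose2[OF smooth_on_continuous[OF smab]])
       (use in_W in \<open>auto intro!: continuous_intros simp: abs_le_iff\<close>)
  have cG: "continuous_on {-d..d} (G 0)"
    using continuous_on_compose2[OF c1, of "{-d..d}" "\<lambda>t. (0,t)"] d
    by (fastforce intro: continuous_intros)
  have db: "((\<lambda>t. h (x + s *\<^sub>R a + t *\<^sub>R b)) has_real_derivative pd b h (x + s *\<^sub>R a + t *\<^sub>R b)) (at t within S)"
    if "smooth_on W h" "\<bar>s\<bar> \<le> d" "\<bar>t\<bar> \<le> d" for h s t S
    by (rule pd_along_line[of h "x + s *\<^sub>R a" t b]) (use that in_W smooth_on_differentiable in blast)
  have da: "((\<lambda>s. h (x + s *\<^sub>R a + t *\<^sub>R b)) has_real_derivative pd a h (x + s *\<^sub>R a + t *\<^sub>R b)) (at s within S)"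
    if "smooth_on W h" "\<bar>s\<bar> \<le> d" "\<bar>t\<bar> \<le> d" for h s t S
    using pd_along_line[of h "x + t *\<^sub>R b" s a S] smooth_on_differentiable[OF that(1) in_W[OF that(2,3)]]
    by (simp add: algebra_simps)
  \<comment> \<open>\<open>I\<close> and \<open>L\<close> compute the \<open>a\<close>-derivative of
    the same increment in two ways, by differentiating the integral and by differentiating its end
    values.\<close>
  have key: "pd a f (x + t *\<^sub>R b) = pd a f x + integral {0..t} (G 0)" if t: "t \<in> {0..d}" for t
  proof -
    have I: "integral (cbox 0 t) (\<lambda>\<tau>. pd b f (x + s *\<^sub>R a + \<tau> *\<^sub>R b))
        = f (x + s *\<^sub>R a + t *\<^sub>R b) - f (x + s *\<^sub>R a)" if "s \<in> {-d..d}" for s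
    proof -
      have "((\<lambda>\<tau>. pd b f (x + s *\<^sub>R a + \<tau> *\<^sub>R b)) has_integral
        f (x + s *\<^sub>R a + t *\<^sub>R b) - f (x + s *\<^sub>R a + 0 *\<^sub>R b)) {0..t}"
        by (rule fundamental_theorem_of_calculus)
           (use that t db[OF f] in \<open>auto simp flip: has_real_derivative_iff_has_vector_derivative simp: abs_le_iff\<close>)
      then show ?thesis by (simp add: integral_unique)
    qed
    have L: "((\<lambda>s. integral (cbox 0 t) (\<lambda>\<tau>. pd b f (x + s *\<^sub>R a + \<tau> *\<^sub>R b)))
        has_real_derivative integral (cbox 0 t) (G 0)) (at 0 within {-d..d})"
    proof (rule leibniz_rule_field_derivative[where f="\<lambda>s \<tau>. pd b f (x + s *\<^sub>R a + \<tau> *\<^sub>R b)" and fx=G])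
      show "((\<lambda>s. pd b f (x + s *\<^sub>R a + \<tau> *\<^sub>R b)) has_real_derivative G s \<tau>) (at s within {-d..d})"
        if "s \<in> {-d..d}" "\<tau> \<in> cbox 0 t" for s \<tau>
        unfolding G_def by (rule da[OF smb]) (use that t in \<open>auto simp: abs_le_iff\<close>)
      show "(\<lambda>\<tau>. pd b f (x + s *\<^sub>R a + \<tau> *\<^sub>R b)) integrable_on cbox 0 t" if "s \<in> {-d..d}" for s
        by (rule integrable_continuous, rule continuous_on_compose2[OF smooth_on_continuous[OF smb]])
           (use that t in_W in \<open>auto intro!: continuous_intros simp: abs_le_iff\<close>)
      show "continuous_on ({-d..d} \<times> cbox 0 t) (\<lambda>(s,\<tau>). G s \<tau>)"
        by (rule continuous_on_subset[OF c1]) (use t in auto)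
    qed (use d in auto)
    have "((\<lambda>s. f (x + s *\<^sub>R a + t *\<^sub>R b) - f (x + s *\<^sub>R a + 0 *\<^sub>R b)) has_real_derivative
        integral (cbox 0 t) (G 0)) (at 0 within {-d..d})"
      by (rule has_field_derivative_transform_within[OF L zero_less_one]) (use d I in auto)
    moreover have "((\<lambda>s. f (x + s *\<^sub>R a + t *\<^sub>R b) - f (x + s *\<^sub>R a + 0 *\<^sub>R b)) has_real_derivative
        pd a f (x + 0 *\<^sub>R a + t *\<^sub>R b) - pd a f (x + 0 *\<^sub>R a + 0 *\<^sub>R b)) (at 0 within {-d..d})"
      by (intro derivative_intros da[OF f]) (use d t in auto)
    ultimately have "integral (cbox 0 t) (G 0) =
        pd a f (x + 0 *\<^sub>R a + t *\<^sub>R b) - pd a f (x + 0 *\<^sub>R a + 0 *\<^sub>R b)"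
      using d by (simp add: at_within_Icc_at DERIV_unique)
    then show ?thesis by simp
  qed
  have "((\<lambda>t. integral {0..t} (G 0)) has_real_derivative G 0 0) (at 0 within {0..d})"
    by (rule integral_has_real_derivative) (use d continuous_on_subset[OF cG] in auto)
  then have "((\<lambda>t. pd a f x + integral {0..t} (G 0)) has_real_derivative G 0 0) (at 0 within {0..d})"
    by (auto intro!: derivative_eq_intros)
  then have "((\<lambda>t. pd a f (x + t *\<^sub>R b)) has_real_derivative G 0 0) (at 0 within {0..d})"
    by (rule has_field_derivative_transform_within[OF _ zero_less_one]) (use key d in auto)
  moreover have "((\<lambda>t. pd a f (x + t *\<^sub>R b)) has_real_derivative pd b (pd a f) x) (at 0 within {0..d})"
    using db[OF sma, of 0 0 "{0..d}"] d by simp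
  \<comment> \<open>Both derivatives at 0 are one-sided; they agree because 0 is a limit point of
    the interval.\<close>
  moreover have "at (0::real) within {0..d} \<noteq> bot"
    using d by (simp add: trivial_limit_within islimpt_Icc)
  ultimately show ?thesis
    unfolding G_def has_field_derivative_iff using tendsto_unique by fastforce
qed


subsection \<open>The wave operator in Boyer--Lindquist coordinates\<close>

lemma vector_4 [simp]:
  "(vector [x, y, z, w] :: 'a::zero^4) $ 1 = x"
  "(vector [x, y, z, w] :: 'a::zero^4) $ 2 = y"
  "(vector [x, y, z, w] :: 'a::zero^4) $ 3 = z"
  "(vector [x, y, z, w] :: 'a::zero^4) $ 4 = w"
  unfolding vector_def by simp_all

text \<open>The zero pattern is that of \<open>metric\<close>, in which only the first and fourth
  coordinates (t and \<phi>) mix.\<close>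

lemma det_4_block:
  fixes A :: "'a::comm_ring_1^4^4"
  assumes "A$1$2 = 0" "A$1$3 = 0" "A$2$1 = 0" "A$2$3 = 0" "A$2$4 = 0"
    "A$3$1 = 0" "A$3$2 = 0" "A$3$4 = 0" "A$4$2 = 0" "A$4$3 = 0"
  shows "det A = (A$1$1 * A$4$4 - A$1$4 * A$4$1) * A$2$2 * A$3$3"
proof -
  have f1234: "finite {2::4, 3, 4}" "1 \<notin> {2::4, 3, 4}" by auto
  have f234: "finite {3::4, 4}" "2 \<notin> {3::4, 4}" by auto
  have f34: "finite {4::4}" "3 \<notin> {4::4}" by auto
  show ?thesis
    unfolding det_def UNIV_4
    unfolding sum_over_permutations_insert[OF f1234]
    unfolding sum_over_permutations_insert[OF f234]
    unfolding sum_over_permutations_insert[OF f34]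
    unfolding permutes_sing
    by (simp add: sign_swap_id permutation_swap_id sign_compose sign_id swap_id_eq
        permutation_compose assms algebra_simps)
qed

lemma matrix_inv_eqI:
  fixes A :: "'a::semiring_1^'n^'n"
  assumes "A ** B = mat 1" "B ** A = mat 1"
  shows "matrix_inv A = B"
proof -
  have "A ** matrix_inv A = mat 1 \<and> matrix_inv A ** A = mat 1"
    unfolding matrix_inv_def by (rule someI[of _ B]) (use assms in simp)
  then have "matrix_inv A ** (A ** B) = B"
    by (simp add: matrix_mul_assoc)
  then show ?thesis using assms by simp
qed

text \<open>Up to scaling, \<open>k\<close> and \<open>l\<close> are the frame dual to the covectors
  \<open>e0\<close> and \<open>e3\<close> of \<open>metric\<close>: \<open>e0\<close> takes the
  value rho^2 on \<open>k\<close> and 0 on \<open>l\<close>, while \<open>e3\<close> takes 0 on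
  \<open>k\<close> and rho^2 / sin \<theta> on \<open>l\<close>.\<close>

definition inverse_metric :: "real \<Rightarrow> real \<Rightarrow> real \<Rightarrow> real^4 \<Rightarrow> real^4^4" where
  "inverse_metric M a Q q =
    (let r = q $ 2; \<theta> = q $ 3;
         k = (vector [r\<^sup>2 + a\<^sup>2, 0, 0, a] :: real^4);
         l = (vector [a * sin \<theta>, 0, 0, 1 / sin \<theta>] :: real^4);
         e1 = (vector [0, 1, 0, 0] :: real^4);
         e2 = (vector [0, 0, 1, 0] :: real^4)
     in \<chi> i j. (l $ i * l $ j - k $ i * k $ j / Delta M a Q r
             + Delta M a Q r * e1 $ i * e1 $ j + e2 $ i * e2 $ j) / rho2 a r \<theta>)"

lemma rho2_alt: "rho2 a r \<theta> = r\<^sup>2 + a\<^sup>2 - a\<^sup>2 * (sin \<theta>)\<^sup>2"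
  using sin_cos_squared_add[of \<theta>] by (simp add: rho2_def algebra_simps cos_squared_eq)

lemma rho2_pos: "r > 0 \<Longrightarrow> rho2 a r \<theta> > 0"
  by (simp add: rho2_def add_pos_nonneg)

lemma metric_inverse:
  assumes "Delta M a Q (q $ 2) \<noteq> 0" "q $ 2 > 0" "sin (q $ 3) \<noteq> 0"
  shows "matrix_inv (metric M a Q q) = inverse_metric M a Q q"
proof -
  define r \<theta> where "r = q $ 2" and "\<theta> = q $ 3"
  define D P S where "D = Delta M a Q r" and "P = rho2 a r \<theta>" and "S = sin \<theta>"
  have nz: "D \<noteq> 0" "P \<noteq> 0" "S \<noteq> 0"
    using assms rho2_pos[of r a \<theta>] by (auto simp: D_def P_def S_def r_def \<theta>_def)
  \<comment> \<open>Trading r^2 + a^2 for \<open>P\<close> and \<open>S\<close> makes all entries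
    rational in \<open>a\<close>, \<open>D\<close>, \<open>P\<close>, \<open>S\<close>, so that the
    matrix identities become plain field arithmetic.\<close>
  have A2: "r\<^sup>2 + a\<^sup>2 = P + a\<^sup>2 * S\<^sup>2"
    by (simp add: P_def rho2_alt S_def)
  have "metric M a Q q ** inverse_metric M a Q q = mat 1"
    unfolding metric_def inverse_metric_def Let_def
    unfolding r_def[symmetric] \<theta>_def[symmetric]
    unfolding D_def[symmetric] P_def[symmetric] S_def[symmetric] A2
    using nz
    by (simp add: matrix_matrix_mult_def vec_eq_iff forall_4 sum_4 mat_def, safe)
       (simp_all add: field_simps power2_eq_square)
  moreover have "inverse_metric M a Q q ** metric M a Q q = mat 1"
    using calculation matrix_left_right_inverse by blast
  ultimately show ?thesis by (rule matrix_inv_eqI)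
qed

text \<open>The t-\<phi> block has determinant - \<Delta> sin^2 \<theta>, and its \<Delta> cancels
  the one in the denominator of the radial entry. Hence the volume density is regular at the
  horizon.\<close>

lemma det_metric:
  assumes "Delta M a Q (q $ 2) \<noteq> 0" "q $ 2 > 0"
  shows "det (metric M a Q q) = - (rho2 a (q $ 2) (q $ 3) * sin (q $ 3))\<^sup>2"
proof -
  define r \<theta> where "r = q $ 2" and "\<theta> = q $ 3"
  define D P S where "D = Delta M a Q r" and "P = rho2 a r \<theta>" and "S = sin \<theta>"
  have nz: "D \<noteq> 0" "P \<noteq> 0"
    using assms rho2_pos[of r a \<theta>] by (auto simp: D_def P_def S_def r_def \<theta>_def)
  have A2: "r\<^sup>2 + a\<^sup>2 = P + a\<^sup>2 * S\<^sup>2"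
    by (simp add: P_def rho2_alt S_def)
  show ?thesis
    apply (subst det_4_block)
    unfolding metric_def Let_def
    unfolding r_def[symmetric] \<theta>_def[symmetric]
    unfolding D_def[symmetric] P_def[symmetric] S_def[symmetric] A2
    using nz by (simp_all add: field_simps power2_eq_square)
qed


lemma pd_mult:
  assumes "f differentiable (at x)" "g differentiable (at x)"
  shows "pd b (\<lambda>x. f x * g x) x = f x * pd b g x + pd b f x * g x"
  by (rule pd_eqI) (auto intro!: derivative_eq_intros has_derivative_pd assms)

lemma pd_eq_0:
  fixes f :: "'a::euclidean_space \<Rightarrow> real"
  assumes "f differentiable (at x)" "\<And>t. f (x + t *\<^sub>R b) = f x"
  shows "pd b f x = 0"
proof -
  have "((\<lambda>t. f (x + t *\<^sub>R b)) has_real_derivative pd b f x) (at 0)"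
    using pd_along_line[of f x 0 b UNIV] assms(1) by simp
  then show ?thesis
    using assms(2) DERIV_unique[OF _ DERIV_const] by simp
qed

text \<open>The density rho^2 sin \<theta> cancels the 1 / rho^2 of the inverse metric. Axisymmetry
  is required on an open set because the outer derivatives see neighbouring points. The fourth flux
  survives through the t-\<phi> entry of the inverse and is disposed of only after \<open>f\<close>
  is written without \<phi>.\<close>

lemma box_op_axisymmetric:
  assumes ext: "a\<^sup>2 + Q\<^sup>2 = M\<^sup>2" "M > 0"
    and N: "open N" "N \<subseteq> chart M a Q" "q \<in> N"
    and f: "\<And>y. y \<in> N \<Longrightarrow> pd (axis 4 1) f y = 0"
  shows "sin (q $ 3) * rho2 a (q $ 2) (q $ 3) * box_op (metric M a Q) f q =
      pd (axis 1 1) (\<lambda>y. sin (y $ 3) * (a\<^sup>2 * (sin (y $ 3))\<^sup>2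
          - ((y $ 2)\<^sup>2 + a\<^sup>2)\<^sup>2 / (y $ 2 - M)\<^sup>2) * pd (axis 1 1) f y) q
    + pd (axis 2 1) (\<lambda>y. sin (y $ 3) * (y $ 2 - M)\<^sup>2 * pd (axis 2 1) f y) q
    + pd (axis 3 1) (\<lambda>y. sin (y $ 3) * pd (axis 3 1) f y) q
    + pd (axis 4 1) (\<lambda>y. sin (y $ 3) * (a - a * ((y $ 2)\<^sup>2 + a\<^sup>2) / (y $ 2 - M)\<^sup>2)
          * pd (axis 1 1) f y) q"
proof -
  have chart: "y $ 2 > M" "sin (y $ 3) > 0" if "y \<in> N" for y
    using that N(2) r_plus_extremal[OF ext(1)] by (auto simp: chart_def intro!: sin_gt_zero)
  have sq: "sqrt \<bar>det (metric M a Q y)\<bar> = rho2 a (y $ 2) (y $ 3) * sin (y $ 3)" if "y \<in> N" for y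
    using chart[OF that] ext(2) det_metric[of M a Q y] rho2_pos[of "y $ 2" a "y $ 3"]
    by (simp add: Delta_extremal[OF ext(1)] abs_mult)
  have inv: "matrix_inv (metric M a Q y) = inverse_metric M a Q y" if "y \<in> N" for y
    by (rule metric_inverse) (use chart[OF that] ext(2) in \<open>auto simp: Delta_extremal[OF ext(1)]\<close>)
  define G where "G i y = sqrt \<bar>det (metric M a Q y)\<bar> *
      (\<Sum>j\<in>UNIV. matrix_inv (metric M a Q y) $ i $ j * pd (axis j 1) f y)" for i y
  have rho: "rho2 a (y $ 2) (y $ 3) \<noteq> 0" if "y \<in> N" for y
    using rho2_pos[of "y $ 2" a "y $ 3"] chart[OF that] ext(2) by linarith
  have G1: "G 1 y = sin (y $ 3) * (a\<^sup>2 * (sin (y $ 3))\<^sup>2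
          - ((y $ 2)\<^sup>2 + a\<^sup>2)\<^sup>2 / (y $ 2 - M)\<^sup>2) * pd (axis 1 1) f y"
    and G2: "G 2 y = sin (y $ 3) * (y $ 2 - M)\<^sup>2 * pd (axis 2 1) f y"
    and G3: "G 3 y = sin (y $ 3) * pd (axis 3 1) f y"
    and G4: "G 4 y = sin (y $ 3) * (a - a * ((y $ 2)\<^sup>2 + a\<^sup>2) / (y $ 2 - M)\<^sup>2)
          * pd (axis 1 1) f y"
    if "y \<in> N" for y
    using rho[OF that] f[OF that] chart[OF that]
    by (simp_all add: G_def sq[OF that] inv[OF that] sum_4 inverse_metric_def Let_def
        Delta_extremal[OF ext(1)] power2_eq_square mult_ac)
  have "sin (q $ 3) * rho2 a (q $ 2) (q $ 3) * box_op (metric M a Q) f q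
      = (\<Sum>i\<in>UNIV. pd (axis i 1) (G i) q)"
    using rho[OF N(3)] chart[OF N(3)] unfolding box_op_def G_def[abs_def] sq[OF N(3)] by simp
  also have "\<dots> = pd (axis 1 1) (G 1) q + pd (axis 2 1) (G 2) q + pd (axis 3 1) (G 3) q
      + pd (axis 4 1) (G 4) q"
    by (simp add: sum_4)
  finally show ?thesis
    by (simp only: pd_cong[OF N(1,3) G1] pd_cong[OF N(1,3) G2] pd_cong[OF N(1,3) G3]
        pd_cong[OF N(1,3) G4])
qed

subsection \<open>Reduction to the variables \<open>(v, r, \<theta>)\<close>\<close>

abbreviation dv :: "real \<times> real \<times> real" where "dv \<equiv> (1, 0, 0)"
abbreviation dr :: "real \<times> real \<times> real" where "dr \<equiv> (0, 1, 0)"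
abbreviation dth :: "real \<times> real \<times> real" where "dth \<equiv> (0, 0, 1)"

lemma Basis_coords: "Basis = {dv, dr, dth}"
  by (auto simp: Basis_prod_def zero_prod_def)

lemma pd_coords:
  assumes "g differentiable (at p)"
  shows "pd (x, y, z) g p = x * pd dv g p + y * pd dr g p + z * pd dth g p"
  by (subst pd_expand[OF assms]) (simp add: Basis_coords mult_ac)

lemma tortoise_derivative:
  assumes "a\<^sup>2 + Q\<^sup>2 = M\<^sup>2" "r > M"
  shows "(tortoise M a Q has_real_derivative (r\<^sup>2 + a\<^sup>2) / (r - M)\<^sup>2) (at r)"
proof -
  \<comment> \<open>The interval from \<open>b\<close> to \<open>c\<close> has both \<open>r\<close>
    and the base point M + 1 in its interior and stays to the right of the singularity at M.\<close>
  define b c where "b = (M + min r (M + 1)) / 2" and "c = max r (M + 1) + 1"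
  have bc: "b > M" "b < r" "r < c" "b < M + 1" "M + 1 < c"
    using assms(2) by (auto simp: b_def c_def min_def max_def)
  have "((\<lambda>u. LBINT s=ereal (M + 1)..ereal u. (s\<^sup>2 + a\<^sup>2) / (s - M)\<^sup>2)
      has_vector_derivative (r\<^sup>2 + a\<^sup>2) / (r - M)\<^sup>2) (at r within {b..c})"
    by (rule interval_integral_FTC2) (use bc in \<open>auto intro!: continuous_intros\<close>)
  moreover have "at r within {b..c} = at r"
    using bc by (simp add: at_within_Icc_at)
  ultimately show ?thesis
    unfolding tortoise_def[abs_def] r_plus_extremal[OF assms(1)] Delta_extremal[OF assms(1)]
    by (simp add: has_real_derivative_iff_has_vector_derivative)
qed

section \<open>Spherical points, axial symmetry, and the pullback to a meridian half-plane\<close>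

lemma sph_nth [simp]:
  "sph r \<theta> \<phi> $ 1 = r * sin \<theta> * cos \<phi>" "sph r \<theta> \<phi> $ 2 = r * sin \<theta> * sin \<phi>"
  "sph r \<theta> \<phi> $ 3 = r * cos \<theta>"
  by (simp_all add: sph_def)

lemma norm_sph [simp]: "norm (sph r \<theta> \<phi>) = \<bar>r\<bar>"
proof -
  have "(norm (sph r \<theta> \<phi>))\<^sup>2 = (r * sin \<theta> * cos \<phi>)\<^sup>2 + (r * sin \<theta> * sin \<phi>)\<^sup>2 + (r * cos \<theta>)\<^sup>2"
    unfolding power2_norm_eq_inner inner_vec_def by (simp add: sum_3 power2_eq_square)
  also have "\<dots> = r\<^sup>2 * ((sin \<theta>)\<^sup>2 * ((cos \<phi>)\<^sup>2 + (sin \<phi>)\<^sup>2) + (cos \<theta>)\<^sup>2)"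
    by algebra
  also have "\<dots> = r\<^sup>2"
    by (simp only: sin_cos_squared_add sin_cos_squared_add2 mult_1_right)
  finally show ?thesis
    by (metis abs_norm_cancel power2_eq_iff_nonneg abs_ge_zero power2_abs norm_ge_zero)
qed

lemma sph_surj: "\<exists>\<theta> \<phi>. 0 \<le> \<theta> \<and> \<theta> \<le> pi \<and> x = sph (norm x) \<theta> \<phi>"
proof (cases "x = 0")
  case True
  then show ?thesis
    by (intro exI[of _ 0]) (auto simp: vec_eq_iff forall_3)
next
  case False
  define R where "R = norm x"
  have R: "R > 0" using False by (simp add: R_def)
  have R2: "R\<^sup>2 = (x $ 1)\<^sup>2 + (x $ 2)\<^sup>2 + (x $ 3)\<^sup>2"
    unfolding R_def power2_norm_eq_inner inner_vec_def by (simp add: sum_3 power2_eq_square)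
  have "\<bar>x $ 3 / R\<bar> \<le> 1"
    using component_le_norm_cart[of x 3] R by (simp add: R_def)
  then obtain \<theta> where th: "0 \<le> \<theta>" "\<theta> \<le> pi" "x $ 3 / R = cos \<theta>"
    by (metis arccos abs_le_iff minus_le_iff)
  have s: "sin \<theta> \<ge> 0" using th by (simp add: sin_ge_zero)
  obtain \<phi> where phi: "x $ 1 = R * sin \<theta> * cos \<phi>" "x $ 2 = R * sin \<theta> * sin \<phi>"
  proof -
    have x3: "x $ 3 = R * cos \<theta>" using th R by (simp add: field_simps)
    have e: "(x $ 1)\<^sup>2 + (x $ 2)\<^sup>2 = (R * sin \<theta>)\<^sup>2"
      using R2 by (simp add: x3 power_mult_distrib sin_squared_eq algebra_simps)
    show thesis
    \<comment> \<open>On the axis the azimuth is arbitrary and 0 is taken; elsewhere the normalised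
      first two components lie on the unit circle.\<close>
    proof (cases "R * sin \<theta> = 0")
      case True
      have "(x $ 1)\<^sup>2 + (x $ 2)\<^sup>2 = 0" unfolding e True by simp
      then show thesis using True that[of 0] by (simp add: sum_power2_eq_zero_iff)
    next
      case False
      then have "(x $ 1 / (R * sin \<theta>))\<^sup>2 + (x $ 2 / (R * sin \<theta>))\<^sup>2 = 1"
        using e by (simp add: power_divide add_divide_distrib[symmetric])
      then obtain \<phi> where "x $ 1 / (R * sin \<theta>) = cos \<phi>" "x $ 2 / (R * sin \<theta>) = sin \<phi>"
        using sincos_total_2pi by metis
      then show thesis using False by (intro that[of \<phi>]) (auto simp: field_simps)
    qed
  qed
  then show ?thesis
    using th R unfolding R_def[symmetric]
    by (intro exI[of _ \<theta>] exI[of _ \<phi>]) (auto simp: vec_eq_iff forall_3 field_simps)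
qed

text \<open>The circles of constant r and \<theta> are integral curves of \<open>rot\<close>, so the
  infinitesimal condition integrates to invariance as long as the whole circle lies in
  \<open>D\<close>.\<close>

lemma axisymmetric_sph:
  assumes W: "D \<subseteq> W" "smooth_on W u" and ax: "axisymmetric D u"
    and D: "\<And>\<phi>. (v, sph r \<theta> \<phi>) \<in> D"
  shows "u (v, sph r \<theta> \<phi>) = u (v, sph r \<theta> 0)"
proof -
  have "((\<lambda>\<phi>. u (v, sph r \<theta> \<phi>)) has_real_derivative 0) (at \<phi>)" for \<phi>
  proof -
    have *: "((\<lambda>\<phi>. sph r \<theta> \<phi>) has_derivative (\<lambda>h. h *\<^sub>R rot (sph r \<theta> \<phi>))) (at \<phi>)"
      by (subst has_derivative_componentwise_within)
         (auto simp: Basis_vec_def inner_axis forall_3 rot_def axis_eq_axis exhaust_3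
            intro!: derivative_eq_intros split: if_splits)
    have "((\<lambda>\<phi>. u (v, sph r \<theta> \<phi>)) has_derivative
        (\<lambda>h. pd (0, h *\<^sub>R rot (sph r \<theta> \<phi>)) u (v, sph r \<theta> \<phi>))) (at \<phi>)"
      by (rule has_derivative_compose[OF _ has_derivative_pd, of "\<lambda>\<phi>. (v, sph r \<theta> \<phi>)"])
         (use W D in \<open>auto intro!: derivative_eq_intros * smooth_on_differentiable\<close>)
    moreover have "pd (0, h *\<^sub>R rot (sph r \<theta> \<phi>)) u (v, sph r \<theta> \<phi>) = 0" for h
    proof -
      have "u differentiable (at (v, sph r \<theta> \<phi>))"
        using W D smooth_on_differentiable by blast
      then have "linear (\<lambda>h. pd h u (v, sph r \<theta> \<phi>))"
        unfolding pd_def by (rule linear_frechet_derivative)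
      from linear_scale[OF this, of h "(0, rot (sph r \<theta> \<phi>))"] show ?thesis
        using ax D by (auto simp: axisymmetric_def)
    qed
    ultimately show ?thesis
      by (simp add: has_field_derivative_def lambda_zero)
  qed
  then show ?thesis
    using DERIV_isconst_all by blast
qed

lemma continuous_on_sph:
  fixes f g h :: "'a::t2_space \<Rightarrow> real"
  assumes "continuous_on S f" "continuous_on S g" "continuous_on S h"
  shows "continuous_on S (\<lambda>x. sph (f x) (g x) (h x))"
proof -
  have "continuous_on S (\<lambda>x. sph (f x) (g x) (h x) $ k)" for k
  proof -
    consider "k = 1" | "k = 2" | "k = 3" using exhaust_3 by blast
    then show ?thesis
      by cases (simp_all add: continuous_intros assms)
  qed
  then show ?thesis
    by (subst continuous_on_componentwise) (auto simp: Basis_vec_def inner_axis)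
qed

text \<open>The angle \<theta> ranges over all reals, so the poles are interior points for the
  pulled-back function and \<theta>-derivatives there are ordinary ones.\<close>

definition coord :: "real \<times> real \<times> real \<Rightarrow> spacetime" where
  "coord p = (fst p, sph (fst (snd p)) (snd (snd p)) 0)"

lemma smooth_on_coord:
  assumes "smooth_on W u"
  shows "smooth_on (coord -` W) (\<lambda>p. u (coord p))"
proof (rule smooth_on_compose[OF assms])
  have "continuous_on UNIV coord"
    unfolding coord_def[abs_def] by (auto intro!: continuous_intros continuous_on_sph)
  then show op: "open (coord -` W)"
    using smooth_on_open[OF assms] by (simp add: open_vimage)
  have v: "smooth_on (coord -` W) (\<lambda>p. fst p)" and r: "smooth_on (coord -` W) (\<lambda>p. fst (snd p))"
    and th: "smooth_on (coord -` W) (\<lambda>p. snd (snd p))"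
    by (auto intro!: smooth_on_linear[OF op] bounded_linear_intros)
  have "smooth_on (coord -` W) (\<lambda>p. sin (snd (snd p)))" "smooth_on (coord -` W) (\<lambda>p. cos (snd (snd p)))"
    using th by (auto intro!: smooth_on_compose[OF smooth_on_sin] smooth_on_compose[OF smooth_on_cos] op)
  then have "smooth_on (coord -` W) (\<lambda>p. fst (snd p) * sin (snd (snd p)))"
    "smooth_on (coord -` W) (\<lambda>p. fst (snd p) * cos (snd (snd p)))"
    using r by (auto intro: smooth_on_mult)
  then have sph: "smooth_on (coord -` W) (\<lambda>p. sph (fst (snd p)) (snd (snd p)) 0 $ k)" for k
    using exhaust_3[of k] by (auto intro: smooth_on_const[OF op])
  show "smooth_on (coord -` W) (\<lambda>p. coord p \<bullet> i)" if "i \<in> Basis" for i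
    using that v sph by (auto simp: coord_def Basis_prod_def Basis_vec_def inner_axis)
qed auto


lemmas has_derivative_vec_nth [derivative_intros] =
  bounded_linear.has_derivative[OF bounded_linear_vec_nth]

text \<open>This is \<open>to_ingoing\<close> in the variables (v, r, \<theta>): an axisymmetric
  function does not see the azimuthal shift, so only \<open>tortoise\<close> has to be
  differentiated.\<close>

definition ingoing :: "real \<Rightarrow> real \<Rightarrow> real \<Rightarrow> real^4 \<Rightarrow> real \<times> real \<times> real" where
  "ingoing M a Q y = (y $ 1 + tortoise M a Q (y $ 2), y $ 2, y $ 3)"

lemma has_derivative_ingoing:
  assumes "a\<^sup>2 + Q\<^sup>2 = M\<^sup>2" "y $ 2 > M" "g differentiable (at (ingoing M a Q y))"
  shows "((\<lambda>y. g (ingoing M a Q y)) has_derivative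
    (\<lambda>h. (h $ 1 + ((y $ 2)\<^sup>2 + a\<^sup>2) / (y $ 2 - M)\<^sup>2 * h $ 2) * pd dv g (ingoing M a Q y)
       + h $ 2 * pd dr g (ingoing M a Q y) + h $ 3 * pd dth g (ingoing M a Q y))) (at y)"
proof -
  have T: "((\<lambda>y. tortoise M a Q (y $ 2)) has_derivative
      (\<lambda>h. ((y $ 2)\<^sup>2 + a\<^sup>2) / (y $ 2 - M)\<^sup>2 * h $ 2)) (at y)"
    by (rule has_derivative_compose[of "\<lambda>y. y $ 2" "\<lambda>h. h $ 2", OF _
          tortoise_derivative[OF assms(1,2), unfolded has_field_derivative_def]])
       (auto intro!: derivative_eq_intros)
  have I: "(ingoing M a Q has_derivative
      (\<lambda>h. (h $ 1 + ((y $ 2)\<^sup>2 + a\<^sup>2) / (y $ 2 - M)\<^sup>2 * h $ 2, h $ 2, h $ 3))) (at y)"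
    unfolding ingoing_def[abs_def]
    by (intro has_derivative_Pair has_derivative_add T has_derivative_vec_nth has_derivative_ident)
  have "((\<lambda>y. g (ingoing M a Q y)) has_derivative
    (\<lambda>h. pd (h $ 1 + ((y $ 2)\<^sup>2 + a\<^sup>2) / (y $ 2 - M)\<^sup>2 * h $ 2, h $ 2, h $ 3) g (ingoing M a Q y))) (at y)"
    by (rule has_derivative_compose[OF I has_derivative_pd[OF assms(3)]])
  then show ?thesis
    by (rule has_derivative_eq_rhs) (rule ext, rule pd_coords[OF assms(3)])
qed

text \<open>\<open>T1\<close> carries - (r^2 + a^2)^2 / (r - M)^2 times the second v-derivative and
  \<open>T2\<close> carries the same term with a plus sign. Their sum leaves coefficients without
  denominators.\<close>

lemma reduced_wave_equation_interior:
  assumes ext: "a\<^sup>2 + Q\<^sup>2 = M\<^sup>2" "M > 0"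
    and W: "future M a Q \<tau>0 \<subseteq> W" "smooth_on W u"
    and box: "solves_box M a Q (future M a Q \<tau>0) u (\<lambda>_. 0)"
    and ax: "axisymmetric (future M a Q \<tau>0) u"
    and w: "w = (\<lambda>p. u (coord p))"
    and p: "r > M" "v - r > \<tau>0" "0 < \<theta>" "\<theta> < pi"
  shows "sin \<theta> * (a\<^sup>2 * (sin \<theta>)\<^sup>2 * pd dv (pd dv w) (v, r, \<theta>) + 2 * (r - M) * pd dr w (v, r, \<theta>)
      + (r - M)\<^sup>2 * pd dr (pd dr w) (v, r, \<theta>) + 2 * r * pd dv w (v, r, \<theta>)
      + 2 * (r\<^sup>2 + a\<^sup>2) * pd dv (pd dr w) (v, r, \<theta>))
    + cos \<theta> * pd dth w (v, r, \<theta>) + sin \<theta> * pd dth (pd dth w) (v, r, \<theta>) = 0"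
proof -
  define T where "T = tortoise M a Q"
  define chi where "chi = ingoing M a Q"
  define f where "f = u \<circ> to_ingoing M a Q"
  define N :: "(real^4) set" where "N = {y. M < y $ 2 \<and> \<tau>0 < y $ 1 + T (y $ 2) - y $ 2 \<and> 0 < y $ 3 \<and> y $ 3 < pi}"
  \<comment> \<open>The chart point that \<open>ingoing\<close> sends to (v, r, \<theta>), with
    azimuth 0.\<close>
  define q :: "real^4" where "q = vector [v - T r, r, \<theta>, 0]"
  have q: "q \<in> N" and chi_q: "chi q = (v, r, \<theta>)" and q_nth: "q $ 2 = r" "q $ 3 = \<theta>"
    using p by (simp_all add: q_def N_def chi_def ingoing_def T_def)
  have chart: "N \<subseteq> chart M a Q"
    by (auto simp: N_def chart_def r_plus_extremal[OF ext(1)])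
  have "open N"
  proof -
    \<comment> \<open>The tortoise function is continuous only for r > M, so openness is first
      obtained relative to this open half-space.\<close>
    define A :: "(real^4) set" where "A = {y. M < y $ 2}"
    have A: "open A" unfolding A_def by (intro open_Collect_less continuous_intros)
    have "continuous_on A (\<lambda>y. T (y $ 2))"
    proof (rule continuous_on_compose2[of "{M<..}" T])
      show "continuous_on {M<..} T"
        using tortoise_derivative[OF ext(1)] unfolding T_def
        by (intro continuous_at_imp_continuous_on) (auto intro: DERIV_isCont)
    qed (auto simp: A_def intro!: continuous_intros)
    then have "open (A \<inter> (\<lambda>y. y $ 1 + T (y $ 2) - y $ 2) -` {\<tau>0<..})"
      by (intro continuous_open_preimage A open_greaterThan continuous_intros)
    then have "open (A \<inter> (\<lambda>y. y $ 1 + T (y $ 2) - y $ 2) -` {\<tau>0<..} \<inter> {y. 0 < y $ 3} \<inter> {y. y $ 3 < pi})"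
      by (rule open_Int[OF open_Int]) (intro open_Collect_less continuous_intros)+
    also have "A \<inter> (\<lambda>y. y $ 1 + T (y $ 2) - y $ 2) -` {\<tau>0<..} \<inter> {y. 0 < y $ 3} \<inter> {y. y $ 3 < pi} = N"
      by (auto simp: N_def A_def)
    finally show ?thesis .
  qed
  \<comment> \<open>All azimuths at once, because \<open>axisymmetric_sph\<close> asks for the
    complete circle.\<close>
  have sph_future: "(y $ 1 + T (y $ 2), sph (y $ 2) (y $ 3) \<phi>) \<in> future M a Q \<tau>0" if "y \<in> N" for y \<phi>
    using that ext(2) by (auto simp: N_def future_def exterior_def r_plus_extremal[OF ext(1)])
  have f_chi: "f y = w (chi y)" if "y \<in> N" for y
    using axisymmetric_sph[OF W ax sph_future[OF that]]
    by (simp add: f_def w to_ingoing_def chi_def ingoing_def coord_def T_def)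
  define \<Omega> where "\<Omega> = coord -` W"
  have sm: "smooth_on \<Omega> w"
    unfolding w \<Omega>_def by (rule smooth_on_coord[OF W(2)])
  have Om: "chi y \<in> \<Omega>" if "y \<in> N" for y
    using sph_future[OF that, of 0] W(1)
    by (auto simp: \<Omega>_def coord_def chi_def ingoing_def T_def)
  have D: "((\<lambda>y. g (chi y)) has_derivative
    (\<lambda>h. (h $ 1 + ((y $ 2)\<^sup>2 + a\<^sup>2) / (y $ 2 - M)\<^sup>2 * h $ 2) * pd dv g (chi y)
       + h $ 2 * pd dr g (chi y) + h $ 3 * pd dth g (chi y))) (at y)"
    if "y \<in> N" "smooth_on \<Omega> g" for y g
    unfolding chi_def
    by (rule has_derivative_ingoing[OF ext(1)])
       (use that Om smooth_on_differentiable in \<open>auto simp: N_def chi_def\<close>)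
  have pd_f: "pd b f y = (b $ 1 + ((y $ 2)\<^sup>2 + a\<^sup>2) / (y $ 2 - M)\<^sup>2 * b $ 2) * pd dv w (chi y)
       + b $ 2 * pd dr w (chi y) + b $ 3 * pd dth w (chi y)" if "y \<in> N" for b y
    using pd_cong[OF \<open>open N\<close> that f_chi] pd_eqI[OF D[OF that sm]] by simp
  have f1: "pd (axis 1 1) f y = pd dv w (chi y)"
    and f2: "pd (axis 2 1) f y = ((y $ 2)\<^sup>2 + a\<^sup>2) / (y $ 2 - M)\<^sup>2 * pd dv w (chi y) + pd dr w (chi y)"
    and f3: "pd (axis 3 1) f y = pd dth w (chi y)"
    and f4: "pd (axis 4 1) f y = 0" if "y \<in> N" for y
    by (simp_all add: pd_f[OF that] axis_def)
  have smv: "smooth_on \<Omega> (pd dv w)" and smr: "smooth_on \<Omega> (pd dr w)" and smt: "smooth_on \<Omega> (pd dth w)"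
    using sm by (auto intro: smooth_on_pd simp: Basis_coords)
  have rM: "q $ 2 - M \<noteq> 0" using p q_nth by simp
  have "to_ingoing M a Q q \<in> future M a Q \<tau>0"
    using sph_future[OF q] by (simp add: to_ingoing_def T_def)
  then have "box_op (metric M a Q) f q = 0"
    using box q chart unfolding solves_box_def f_def by blast
  then have eq0: "0 =
      pd (axis 1 1) (\<lambda>y. sin (y $ 3) * (a\<^sup>2 * (sin (y $ 3))\<^sup>2
          - ((y $ 2)\<^sup>2 + a\<^sup>2)\<^sup>2 / (y $ 2 - M)\<^sup>2) * pd (axis 1 1) f y) q
    + pd (axis 2 1) (\<lambda>y. sin (y $ 3) * (y $ 2 - M)\<^sup>2 * pd (axis 2 1) f y) q
    + pd (axis 3 1) (\<lambda>y. sin (y $ 3) * pd (axis 3 1) f y) q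
    + pd (axis 4 1) (\<lambda>y. sin (y $ 3) * (a - a * ((y $ 2)\<^sup>2 + a\<^sup>2) / (y $ 2 - M)\<^sup>2)
          * pd (axis 1 1) f y) q" (is "_ = ?T1 + ?T2 + ?T3 + ?T4")
    using box_op_axisymmetric[OF ext \<open>open N\<close> chart q f4] by simp
  have dw: "(\<lambda>y. pd dv w (chi y)) differentiable (at q)"
    using D[OF q smv] by (rule differentiableI)
  have T1: "?T1 = sin \<theta> * (a\<^sup>2 * (sin \<theta>)\<^sup>2 - (r\<^sup>2 + a\<^sup>2)\<^sup>2 / (r - M)\<^sup>2) * pd dv (pd dv w) (v, r, \<theta>)"
  proof -
    let ?c = "\<lambda>y::real^4. sin (y $ 3) * (a\<^sup>2 * (sin (y $ 3))\<^sup>2 - ((y $ 2)\<^sup>2 + a\<^sup>2)\<^sup>2 / (y $ 2 - M)\<^sup>2)"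
    have "?T1 = pd (axis 1 1) (\<lambda>y. ?c y * pd dv w (chi y)) q"
      by (rule pd_cong[OF \<open>open N\<close> q]) (simp add: f1)
    also have "\<dots> = ?c q * pd (axis 1 1) (\<lambda>y. pd dv w (chi y)) q + pd (axis 1 1) ?c q * pd dv w (chi q)"
      by (rule pd_mult) (use rM in \<open>auto intro!: derivative_eq_intros differentiableI dw\<close>)
    also have "pd (axis 1 1) ?c q = 0"
      by (rule pd_eq_0) (use rM in \<open>auto intro!: derivative_eq_intros differentiableI simp: axis_def\<close>)
    finally show ?thesis
      using pd_eqI[OF D[OF q smv], of "axis 1 1"] by (simp add: q_nth chi_q axis_def)
  qed
  have T2: "?T2 = sin \<theta> * (2 * (r - M) * pd dr w (v, r, \<theta>)
      + (r - M)\<^sup>2 * pd dr (pd dr w) (v, r, \<theta>) + 2 * r * pd dv w (v, r, \<theta>)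
      + 2 * (r\<^sup>2 + a\<^sup>2) * pd dv (pd dr w) (v, r, \<theta>)
      + (r\<^sup>2 + a\<^sup>2)\<^sup>2 / (r - M)\<^sup>2 * pd dv (pd dv w) (v, r, \<theta>))"
  proof -
    \<comment> \<open>Differentiating the radial flux produces both mixed derivatives; they merge
      into the single term with coefficient 2 (r^2 + a^2).\<close>
    have comm: "pd dr (pd dv w) (v, r, \<theta>) = pd dv (pd dr w) (v, r, \<theta>)"
      by (rule pd_commute[OF sm]) (use Om[OF q] chi_q in \<open>auto simp: Basis_coords\<close>)
    \<comment> \<open>Here \<open>c\<close> stands for r^2 + a^2, \<open>d\<close> for r - M and
      \<open>e\<close> for (r - M)^2; with these opaque, one cleared denominator proves the
      identity.\<close>
    have *: "s * (2 * r' * V + c * (c / e * W + X) + 2 * d * R + e * (c / e * X + Y))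
        = s * (2 * d * R + e * Y + 2 * r' * V + 2 * c * X + c\<^sup>2 / e * W)"
      if "e \<noteq> 0" for s r' V c e W X d R Y :: real
      using that by (simp add: field_simps power2_eq_square)
    \<comment> \<open>Multiplying by (r - M)^2 before differentiating removes the denominator from
      the radial flux.\<close>
    have "?T2 = pd (axis 2 1) (\<lambda>y. sin (y $ 3) *
        (((y $ 2)\<^sup>2 + a\<^sup>2) * pd dv w (chi y) + (y $ 2 - M)\<^sup>2 * pd dr w (chi y))) q"
      by (rule pd_cong[OF \<open>open N\<close> q]) (auto simp: f2 N_def field_simps)
    also have "\<dots> = sin (q $ 3) * (2 * q $ 2 * pd dv w (chi q)
        + ((q $ 2)\<^sup>2 + a\<^sup>2) * (((q $ 2)\<^sup>2 + a\<^sup>2) / (q $ 2 - M)\<^sup>2 * pd dv (pd dv w) (chi q)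
             + pd dr (pd dv w) (chi q))
        + 2 * (q $ 2 - M) * pd dr w (chi q)
        + (q $ 2 - M)\<^sup>2 * (((q $ 2)\<^sup>2 + a\<^sup>2) / (q $ 2 - M)\<^sup>2 * pd dv (pd dr w) (chi q)
             + pd dr (pd dr w) (chi q)))"
      by (rule trans[OF pd_eqI], (rule derivative_eq_intros D[OF q smv] D[OF q smr] refl)+)
         (simp add: axis_def algebra_simps)
    finally show ?thesis
      unfolding chi_q q_nth comm by (rule trans) (rule *, use p(1) in simp)
  qed
  have T3: "?T3 = cos \<theta> * pd dth w (v, r, \<theta>) + sin \<theta> * pd dth (pd dth w) (v, r, \<theta>)"
  proof -
    have "?T3 = pd (axis 3 1) (\<lambda>y. sin (y $ 3) * pd dth w (chi y)) q"
      by (rule pd_cong[OF \<open>open N\<close> q]) (simp add: f3)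
    also have "\<dots> = cos (q $ 3) * pd dth w (chi q) + sin (q $ 3) * pd dth (pd dth w) (chi q)"
      by (rule trans[OF pd_eqI], (rule derivative_eq_intros D[OF q smt] refl)+)
         (simp add: axis_def algebra_simps)
    finally show ?thesis by (simp add: chi_q q_nth)
  qed
  \<comment> \<open>Neither the coefficient nor \<open>chi\<close> involves the fourth coordinate,
    so the flux is constant along that axis.\<close>
  have T4: "?T4 = 0"
  proof -
    let ?c = "\<lambda>y::real^4. sin (y $ 3) * (a - a * ((y $ 2)\<^sup>2 + a\<^sup>2) / (y $ 2 - M)\<^sup>2)"
    have "?T4 = pd (axis 4 1) (\<lambda>y. ?c y * pd dv w (chi y)) q"
      by (rule pd_cong[OF \<open>open N\<close> q]) (simp add: f1)
    also have "\<dots> = 0"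
    proof (rule pd_eq_0)
      have "?c differentiable (at q)"
        using rM by (auto intro!: derivative_eq_intros differentiableI)
      then show "(\<lambda>y. ?c y * pd dv w (chi y)) differentiable (at q)"
        using dw by (rule differentiable_mult)
    qed (simp add: axis_def chi_def ingoing_def)
    finally show ?thesis .
  qed
  show ?thesis
    using eq0 unfolding T1 T2 T3 T4 by (simp add: algebra_simps)
qed


text \<open>Every point of the closed region, including horizon, initial slice and poles, is the
  endpoint of a path through the interior, and the left side is continuous along it.\<close>

lemma reduced_wave_equation:
  assumes ext: "a\<^sup>2 + Q\<^sup>2 = M\<^sup>2" "M > 0"
    and W: "future M a Q \<tau>0 \<subseteq> W" "smooth_on W u"
    and box: "solves_box M a Q (future M a Q \<tau>0) u (\<lambda>_. 0)"
    and ax: "axisymmetric (future M a Q \<tau>0) u"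
    and w: "w = (\<lambda>p. u (coord p))"
    and p: "r \<ge> M" "v - r \<ge> \<tau>0" "0 \<le> \<theta>" "\<theta> \<le> pi"
  shows "sin \<theta> * (a\<^sup>2 * (sin \<theta>)\<^sup>2 * pd dv (pd dv w) (v, r, \<theta>) + 2 * (r - M) * pd dr w (v, r, \<theta>)
      + (r - M)\<^sup>2 * pd dr (pd dr w) (v, r, \<theta>) + 2 * r * pd dv w (v, r, \<theta>)
      + 2 * (r\<^sup>2 + a\<^sup>2) * pd dv (pd dr w) (v, r, \<theta>))
    + cos \<theta> * pd dth w (v, r, \<theta>) + sin \<theta> * pd dth (pd dth w) (v, r, \<theta>) = 0"
proof -
  define \<Omega> where "\<Omega> = coord -` W"
  have sm: "smooth_on \<Omega> w"
    unfolding w \<Omega>_def by (rule smooth_on_coord[OF W(2)])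
  define E where "E = (\<lambda>(v, r, \<theta>). sin \<theta> * (a\<^sup>2 * (sin \<theta>)\<^sup>2 * pd dv (pd dv w) (v, r, \<theta>) + 2 * (r - M) * pd dr w (v, r, \<theta>)
      + (r - M)\<^sup>2 * pd dr (pd dr w) (v, r, \<theta>) + 2 * r * pd dv w (v, r, \<theta>)
      + 2 * (r\<^sup>2 + a\<^sup>2) * pd dv (pd dr w) (v, r, \<theta>))
    + cos \<theta> * pd dth w (v, r, \<theta>) + sin \<theta> * pd dth (pd dth w) (v, r, \<theta>))"
  \<comment> \<open>For 0 < e < 1 the path lies in the interior: r grows by \<open>e\<close>, v by 2
    e so that v - r grows as well, and \<theta> moves convexly towards the equator.\<close>
  define \<gamma> where "\<gamma> e = (v + 2 * e, r + e, \<theta> + e * (pi / 2 - \<theta>))" for e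
  have \<gamma>: "\<gamma> e \<in> \<Omega>" if "e \<ge> 0" for e
    using W(1) p ext(2) that
    by (auto simp: \<gamma>_def \<Omega>_def coord_def future_def exterior_def r_plus_extremal[OF ext(1)])
  have c\<gamma>: "continuous_on {0..1} (\<lambda>e. g (\<gamma> e))" if "smooth_on \<Omega> g" for g
    by (rule continuous_on_compose2[OF smooth_on_continuous[OF that]])
       (use \<gamma> in \<open>auto simp: \<gamma>_def[abs_def] intro!: continuous_intros\<close>)
  have "continuous_on {0..1} (\<lambda>e. E (\<gamma> e))"
  proof -
    have "smooth_on \<Omega> (pd dv (pd dv w))" "smooth_on \<Omega> (pd dr w)" "smooth_on \<Omega> (pd dr (pd dr w))"
      "smooth_on \<Omega> (pd dv w)" "smooth_on \<Omega> (pd dv (pd dr w))" "smooth_on \<Omega> (pd dth w)"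
      "smooth_on \<Omega> (pd dth (pd dth w))"
      using sm by (auto intro!: smooth_on_pd simp: Basis_coords)
    note c = this[THEN c\<gamma>, unfolded \<gamma>_def]
    show ?thesis
      unfolding E_def \<gamma>_def prod.case by (intro continuous_intros c)
  qed
  then have "((\<lambda>e. E (\<gamma> e)) \<longlongrightarrow> E (\<gamma> 0)) (at 0 within {0..1})"
    by (simp add: continuous_on_def)
  then have "((\<lambda>e. E (\<gamma> e)) \<longlongrightarrow> E (\<gamma> 0)) (at_right 0)"
    by (rule filterlim_mono) (auto simp: at_within_Icc_at_right)
  moreover have "\<forall>\<^sub>F e in at_right 0. E (\<gamma> e) = 0"
  proof -
    have "\<forall>\<^sub>F e in at_right (0::real). e \<in> {0<..<1}"
      by (rule eventually_at_rightI) auto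
    then show ?thesis
    proof eventually_elim
      fix e :: real assume e: "e \<in> {0<..<1}"
      have "0 < (1 - e) * \<theta> + e * (pi / 2)"
        by (rule add_nonneg_pos) (use e p in auto)
      moreover have "0 < (1 - e) * (pi - \<theta>) + e * (pi / 2)"
        by (rule add_nonneg_pos) (use e p in auto)
      ultimately have "0 < \<theta> + e * (pi / 2 - \<theta>)" "\<theta> + e * (pi / 2 - \<theta>) < pi"
        by (auto simp: algebra_simps)
      then show "E (\<gamma> e) = 0"
        unfolding E_def \<gamma>_def prod.case
        by (intro reduced_wave_equation_interior[OF ext W box ax w]) (use e p in auto)
    qed
  qed
  then have "((\<lambda>e. E (\<gamma> e)) \<longlongrightarrow> 0) (at_right 0)"
    by (rule tendsto_eventually)
  ultimately have "E (\<gamma> 0) = 0"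
    using tendsto_unique trivial_limit_at_right_real by blast
  then show ?thesis by (simp add: E_def \<gamma>_def)
qed

text \<open>The parameter \<open>dom\<close> lets the same calculus serve solutions on the future of
  a slice and stationary states, which exist for all v. The set \<open>\<Omega>\<close> is an open
  neighbourhood that reaches past the horizon.\<close>

locale reduced_wave =
  fixes M a :: real and dom :: "real \<Rightarrow> real \<Rightarrow> bool" and \<Omega> :: "(real \<times> real \<times> real) set"
    and w :: "real \<times> real \<times> real \<Rightarrow> real"
  assumes smooth: "smooth_on \<Omega> w"
    and in_domain: "dom v r \<Longrightarrow> (v, r, \<theta>) \<in> \<Omega>"
    and equation: "dom v r \<Longrightarrow> 0 \<le> \<theta> \<Longrightarrow> \<theta> \<le> pi \<Longrightarrow>
      sin \<theta> * (a\<^sup>2 * (sin \<theta>)\<^sup>2 * pd dv (pd dv w) (v, r, \<theta>) + 2 * (r - M) * pd dr w (v, r, \<theta>)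
      + (r - M)\<^sup>2 * pd dr (pd dr w) (v, r, \<theta>) + 2 * r * pd dv w (v, r, \<theta>)
      + 2 * (r\<^sup>2 + a\<^sup>2) * pd dv (pd dr w) (v, r, \<theta>))
    + cos \<theta> * pd dth w (v, r, \<theta>) + sin \<theta> * pd dth (pd dth w) (v, r, \<theta>) = 0"
begin

lemma smooth_pd:
  assumes "smooth_on \<Omega> g"
  shows "smooth_on \<Omega> (pd dv g)" "smooth_on \<Omega> (pd dr g)" "smooth_on \<Omega> (pd dth g)"
  using assms by (auto intro!: smooth_on_pd simp: Basis_coords)

lemmas smooth_derivatives = smooth smooth_pd[OF smooth] smooth_pd(1,2,3)[OF smooth_pd(1)[OF smooth]]
  smooth_pd(1,2,3)[OF smooth_pd(2)[OF smooth]] smooth_pd(1,2,3)[OF smooth_pd(3)[OF smooth]]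

lemma partial_derivatives:
  assumes "smooth_on \<Omega> g" "dom v r"
  shows "((\<lambda>v. g (v, r, \<theta>)) has_real_derivative pd dv g (v, r, \<theta>)) (at v within S)"
    and "((\<lambda>r. g (v, r, \<theta>)) has_real_derivative pd dr g (v, r, \<theta>)) (at r within S)"
    and "((\<lambda>\<theta>. g (v, r, \<theta>)) has_real_derivative pd dth g (v, r, \<theta>)) (at \<theta> within S)"
proof -
  have d: "g differentiable (at (v, r, \<theta>))"
    using smooth_on_differentiable[OF assms(1) in_domain[OF assms(2)]] .
  show "((\<lambda>v. g (v, r, \<theta>)) has_real_derivative pd dv g (v, r, \<theta>)) (at v within S)"
    using pd_along_line[of g "(0, r, \<theta>)" v dv] d by simp
  show "((\<lambda>r. g (v, r, \<theta>)) has_real_derivative pd dr g (v, r, \<theta>)) (at r within S)"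
    using pd_along_line[of g "(v, 0, \<theta>)" r dr] d by simp
  show "((\<lambda>\<theta>. g (v, r, \<theta>)) has_real_derivative pd dth g (v, r, \<theta>)) (at \<theta> within S)"
    using pd_along_line[of g "(v, r, 0)" \<theta> dth] d by simp
qed

lemma continuous_on_reduced:
  assumes "smooth_on \<Omega> g" "\<And>x. x \<in> S \<Longrightarrow> dom (V x) (R x)"
    "continuous_on S V" "continuous_on S R" "continuous_on S \<Theta>"
  shows "continuous_on S (\<lambda>x. g (V x, R x, \<Theta> x))"
  by (rule continuous_on_compose2[OF smooth_on_continuous[OF assms(1)]])
     (use assms in_domain in \<open>auto intro!: continuous_intros\<close>)

text \<open>\<open>charge\<close> with \<open>pd\<close> in place of \<open>deriv\<close>, the form
  in which differentiation under the integral applies. The two are identified in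
  \<open>charge_conserved\<close>.\<close>

definition horizon_charge :: "real \<Rightarrow> real" where
  "horizon_charge v = integral {0..pi} (\<lambda>\<theta>. (2 * (M\<^sup>2 + a\<^sup>2) * pd dr w (v, M, \<theta>)
      + 2 * M * w (v, M, \<theta>) + a\<^sup>2 * (sin \<theta>)\<^sup>2 * pd dv w (v, M, \<theta>)) * sin \<theta>)"

lemma horizon_charge_conserved:
  assumes dom: "\<And>v. v \<in> {v0..} \<Longrightarrow> dom v M" and v: "v \<in> {v0..}"
  shows "(horizon_charge has_real_derivative 0) (at v within {v0..})"
proof -
  define fx where "fx v \<theta> = (2 * (M\<^sup>2 + a\<^sup>2) * pd dv (pd dr w) (v, M, \<theta>)
      + 2 * M * pd dv w (v, M, \<theta>) + a\<^sup>2 * (sin \<theta>)\<^sup>2 * pd dv (pd dv w) (v, M, \<theta>)) * sin \<theta>" for v \<theta>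
  have "(horizon_charge has_real_derivative integral (cbox 0 pi) (fx v)) (at v within {v0..})"
    unfolding horizon_charge_def[abs_def] box_real[symmetric]
  proof (rule leibniz_rule_field_derivative)
    show "((\<lambda>v. (2 * (M\<^sup>2 + a\<^sup>2) * pd dr w (v, M, \<theta>) + 2 * M * w (v, M, \<theta>)
        + a\<^sup>2 * (sin \<theta>)\<^sup>2 * pd dv w (v, M, \<theta>)) * sin \<theta>) has_real_derivative fx v \<theta>) (at v within {v0..})"
      if "v \<in> {v0..}" for v \<theta>
      unfolding fx_def
      by (auto intro!: derivative_eq_intros partial_derivatives smooth_derivatives dom[OF that])
    show "(\<lambda>\<theta>. (2 * (M\<^sup>2 + a\<^sup>2) * pd dr w (v, M, \<theta>) + 2 * M * w (v, M, \<theta>)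
        + a\<^sup>2 * (sin \<theta>)\<^sup>2 * pd dv w (v, M, \<theta>)) * sin \<theta>) integrable_on cbox 0 pi"
      if "v \<in> {v0..}" for v
      by (intro integrable_continuous continuous_intros continuous_on_reduced smooth_derivatives dom[OF that])
    show "continuous_on ({v0..} \<times> cbox 0 pi) (\<lambda>(v, \<theta>). fx v \<theta>)"
      unfolding fx_def case_prod_unfold
      by (intro continuous_intros continuous_on_reduced smooth_derivatives dom) auto
  qed (use v in auto)
  moreover have "integral (cbox 0 pi) (fx v) = 0"
  proof -
    \<comment> \<open>At r = M the equation makes the integrand an exact \<theta>-derivative, and
      its primitive carries a factor sin \<theta> that vanishes at both poles.\<close>
    have "(fx v has_integral - (sin pi * pd dth w (v, M, pi)) - - (sin 0 * pd dth w (v, M, 0))) {0..pi}"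
    proof (rule fundamental_theorem_of_calculus)
      show "((\<lambda>\<theta>. - (sin \<theta> * pd dth w (v, M, \<theta>))) has_vector_derivative fx v \<theta>) (at \<theta> within {0..pi})"
        if "\<theta> \<in> {0..pi}" for \<theta>
      proof -
        have "fx v \<theta> = - (cos \<theta> * pd dth w (v, M, \<theta>) + sin \<theta> * pd dth (pd dth w) (v, M, \<theta>))"
          using equation[OF dom[OF v], of \<theta>] that by (simp add: fx_def algebra_simps)
        moreover have "((\<lambda>\<theta>. - (sin \<theta> * pd dth w (v, M, \<theta>))) has_real_derivative
            - (cos \<theta> * pd dth w (v, M, \<theta>) + sin \<theta> * pd dth (pd dth w) (v, M, \<theta>))) (at \<theta> within {0..pi})"
          by (auto intro!: derivative_eq_intros partial_derivatives smooth_derivatives dom[OF v])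
        ultimately show ?thesis
          by (simp add: has_real_derivative_iff_has_vector_derivative)
      qed
    qed simp
    then show ?thesis by (simp add: integral_unique)
  qed
  ultimately show ?thesis by simp
qed

end

section \<open>The charge of a regular solution and its consequence for transversal
  derivatives\<close>

lemma regular_solution_reduced:
  assumes ext: "a\<^sup>2 + Q\<^sup>2 = M\<^sup>2" "M > 0" and u: "regular_solution M a Q \<tau>0 u"
  obtains \<Omega> where "reduced_wave M a (\<lambda>v r. M \<le> r \<and> \<tau>0 \<le> v - r) \<Omega> (\<lambda>p. u (coord p))"
proof -
  obtain W where W: "future M a Q \<tau>0 \<subseteq> W" "smooth_on W u"
    using u by (auto simp: regular_solution_def smooth_up_to_def)
  have "reduced_wave M a (\<lambda>v r. M \<le> r \<and> \<tau>0 \<le> v - r) (coord -` W) (\<lambda>p. u (coord p))"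
  proof
    show "(v, r, \<theta>) \<in> coord -` W" if "M \<le> r \<and> \<tau>0 \<le> v - r" for v r \<theta>
      using that W(1) ext(2)
      by (auto simp: coord_def future_def exterior_def r_plus_extremal[OF ext(1)])
    show "sin \<theta> * (a\<^sup>2 * (sin \<theta>)\<^sup>2 * pd dv (pd dv (\<lambda>p. u (coord p))) (v, r, \<theta>)
        + 2 * (r - M) * pd dr (\<lambda>p. u (coord p)) (v, r, \<theta>)
        + (r - M)\<^sup>2 * pd dr (pd dr (\<lambda>p. u (coord p))) (v, r, \<theta>)
        + 2 * r * pd dv (\<lambda>p. u (coord p)) (v, r, \<theta>)
        + 2 * (r\<^sup>2 + a\<^sup>2) * pd dv (pd dr (\<lambda>p. u (coord p))) (v, r, \<theta>))
      + cos \<theta> * pd dth (\<lambda>p. u (coord p)) (v, r, \<theta>)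
      + sin \<theta> * pd dth (pd dth (\<lambda>p. u (coord p))) (v, r, \<theta>) = 0"
      if "M \<le> r \<and> \<tau>0 \<le> v - r" "0 \<le> \<theta>" "\<theta> \<le> pi" for v r \<theta>
      using u that by (intro reduced_wave_equation[OF ext W]) (auto simp: regular_solution_def)
  qed (rule smooth_on_coord[OF W(2)])
  then show thesis ..
qed

lemma in_coords_coord: "in_coords u v r \<theta> 0 = u (coord (v, r, \<theta>))"
  by (simp add: in_coords_def coord_def)

context
  fixes M a Q \<tau>0 :: real and u :: "spacetime \<Rightarrow> real"
  assumes ext: "a\<^sup>2 + Q\<^sup>2 = M\<^sup>2" "M > 0" and u: "regular_solution M a Q \<tau>0 u"
begin

text \<open>The two-sided \<open>deriv\<close> at r = M exists because \<open>u\<close> is smooth on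
  a neighbourhood of the horizon; it equals a \<open>pd\<close>, which is continuous.\<close>

lemma horizon_quantities_continuous:
  assumes v: "v \<ge> \<tau>0 + M"
  shows "continuous_on {0..pi} (\<lambda>\<theta>. in_coords u v M \<theta> 0)"
    and "continuous_on {0..pi} (\<lambda>\<theta>. deriv (\<lambda>r. in_coords u v r \<theta> 0) M)"
    and "continuous_on {0..pi} (\<lambda>\<theta>. deriv (\<lambda>w. in_coords u w M \<theta> 0) v)"
proof -
  obtain \<Omega> where "reduced_wave M a (\<lambda>v r. M \<le> r \<and> \<tau>0 \<le> v - r) \<Omega> (\<lambda>p. u (coord p))"
    using regular_solution_reduced[OF ext u] .
  then interpret reduced_wave M a "\<lambda>v r. M \<le> r \<and> \<tau>0 \<le> v - r" \<Omega> "\<lambda>p. u (coord p)" .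
  have "deriv (\<lambda>r. in_coords u v r \<theta> 0) M = pd dr (\<lambda>p. u (coord p)) (v, M, \<theta>)"
    and "deriv (\<lambda>w. in_coords u w M \<theta> 0) v = pd dv (\<lambda>p. u (coord p)) (v, M, \<theta>)" for \<theta>
    unfolding in_coords_coord using v
    by (auto intro!: DERIV_imp_deriv partial_derivatives[OF smooth])
  then show "continuous_on {0..pi} (\<lambda>\<theta>. in_coords u v M \<theta> 0)"
    "continuous_on {0..pi} (\<lambda>\<theta>. deriv (\<lambda>r. in_coords u v r \<theta> 0) M)"
    "continuous_on {0..pi} (\<lambda>\<theta>. deriv (\<lambda>w. in_coords u w M \<theta> 0) v)"
    unfolding in_coords_coord using v
    by (auto intro!: continuous_on_reduced smooth_derivatives continuous_intros)
qed

lemma charge_conserved: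
  assumes "v \<ge> \<tau>0 + M"
  shows "(charge M a u has_real_derivative 0) (at v within {\<tau>0 + M..})"
proof -
  obtain \<Omega> where "reduced_wave M a (\<lambda>v r. M \<le> r \<and> \<tau>0 \<le> v - r) \<Omega> (\<lambda>p. u (coord p))"
    using regular_solution_reduced[OF ext u] .
  then interpret reduced_wave M a "\<lambda>v r. M \<le> r \<and> \<tau>0 \<le> v - r" \<Omega> "\<lambda>p. u (coord p)" .
  have "charge M a u v = horizon_charge v" if "v \<ge> \<tau>0 + M" for v
  proof -
    have "deriv (\<lambda>r. in_coords u v r \<theta> 0) M = pd dr (\<lambda>p. u (coord p)) (v, M, \<theta>)"
      and "deriv (\<lambda>w. in_coords u w M \<theta> 0) v = pd dv (\<lambda>p. u (coord p)) (v, M, \<theta>)" for \<theta>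
      unfolding in_coords_coord using that
      by (auto intro!: DERIV_imp_deriv partial_derivatives[OF smooth])
    then show ?thesis
      by (simp add: charge_def horizon_charge_def in_coords_coord)
  qed
  moreover have "(horizon_charge has_real_derivative 0) (at v within {\<tau>0 + M..})"
    by (rule horizon_charge_conserved) (use assms in auto)
  ultimately show ?thesis
    using assms by (elim has_field_derivative_transform_within[OF _ zero_less_one]) auto
qed

lemma charge_constant:
  assumes "v \<ge> \<tau>0 + M" "v' \<ge> \<tau>0 + M"
  shows "charge M a u v = charge M a u v'"
proof -
  have "\<exists>c. \<forall>v\<in>{\<tau>0 + M..}. charge M a u v = c"
    by (rule has_field_derivative_zero_constant) (use charge_conserved in auto)
  then show ?thesis using assms by (metis atLeast_iff)
qed

lemma charge_split:
  assumes "v \<ge> \<tau>0 + M"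
  shows "charge M a u v =
      2 * (M\<^sup>2 + a\<^sup>2) * integral {0..pi} (\<lambda>\<theta>. deriv (\<lambda>r. in_coords u v r \<theta> 0) M * sin \<theta>)
    + 2 * M * integral {0..pi} (\<lambda>\<theta>. in_coords u v M \<theta> 0 * sin \<theta>)
    + a\<^sup>2 * integral {0..pi} (\<lambda>\<theta>. deriv (\<lambda>w. in_coords u w M \<theta> 0) v * (sin \<theta>) ^ 3)"
proof -
  note c = horizon_quantities_continuous[OF assms]
  have "charge M a u v = integral {0..pi} (\<lambda>\<theta>.
      2 * (M\<^sup>2 + a\<^sup>2) * (deriv (\<lambda>r. in_coords u v r \<theta> 0) M * sin \<theta>)
    + 2 * M * (in_coords u v M \<theta> 0 * sin \<theta>)
    + a\<^sup>2 * (deriv (\<lambda>w. in_coords u w M \<theta> 0) v * (sin \<theta>) ^ 3))"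
    unfolding charge_def by (simp add: algebra_simps power2_eq_square power3_eq_cube)
  also have "\<dots> = integral {0..pi} (\<lambda>\<theta>. 2 * (M\<^sup>2 + a\<^sup>2) * (deriv (\<lambda>r. in_coords u v r \<theta> 0) M * sin \<theta>))
    + integral {0..pi} (\<lambda>\<theta>. 2 * M * (in_coords u v M \<theta> 0 * sin \<theta>))
    + integral {0..pi} (\<lambda>\<theta>. a\<^sup>2 * (deriv (\<lambda>w. in_coords u w M \<theta> 0) v * (sin \<theta>) ^ 3))"
    by (subst integral_add, (intro integrable_continuous_interval continuous_intros c)+)+ simp
  finally show ?thesis by (simp only: integral_mult_right)
qed

end

text \<open>The weight bounded by 1 covers both sin and its cube. Continuity is asked only
  eventually, since a solution is regular on the horizon only from v = \<tau>0 + M on.\<close>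

lemma weighted_integral_tendsto_0:
  fixes h :: "real \<Rightarrow> real \<Rightarrow> real"
  assumes lim: "uniform_limit {0..b} h (\<lambda>_. 0) F"
    and cont: "\<forall>\<^sub>F v in F. continuous_on {0..b} (h v)"
    and k: "continuous_on {0..b} k" "\<And>\<theta>. \<bar>k \<theta>\<bar> \<le> 1" and "b > 0"
  shows "((\<lambda>v. integral {0..b} (\<lambda>\<theta>. h v \<theta> * k \<theta>)) \<longlongrightarrow> 0) F"
proof (rule tendstoI)
  fix e :: real assume "e > 0"
  \<comment> \<open>Bounds the integral by \<open>d\<close> times \<open>b\<close>, that is by e /
    2.\<close>
  define d where "d = e / (2 * b)"
  have d: "d > 0" using \<open>e > 0\<close> \<open>b > 0\<close> by (simp add: d_def)
  have "\<forall>\<^sub>F v in F. \<forall>\<theta>\<in>{0..b}. \<bar>h v \<theta>\<bar> < d"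
    using uniform_limitD[OF lim d] by simp
  then show "\<forall>\<^sub>F v in F. dist (integral {0..b} (\<lambda>\<theta>. h v \<theta> * k \<theta>)) 0 < e"
    using cont
  proof eventually_elim
    fix v assume small: "\<forall>\<theta>\<in>{0..b}. \<bar>h v \<theta>\<bar> < d" and c: "continuous_on {0..b} (h v)"
    have "norm (integral {0..b} (\<lambda>\<theta>. h v \<theta> * k \<theta>)) \<le> d * (b - 0)"
    proof (rule integral_bound)
      show "norm (h v \<theta> * k \<theta>) \<le> d" if "\<theta> \<in> {0..b}" for \<theta>
        using mult_mono[of "\<bar>h v \<theta>\<bar>" d "\<bar>k \<theta>\<bar>" 1] small k(2)[of \<theta>] that d
        by (auto simp: abs_mult less_imp_le)
    qed (use \<open>b > 0\<close> c k in \<open>auto intro!: continuous_intros\<close>)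
    also have "\<dots> < e" using \<open>e > 0\<close> \<open>b > 0\<close> by (simp add: d_def)
    finally show "dist (integral {0..b} (\<lambda>\<theta>. h v \<theta> * k \<theta>)) 0 < e" by simp
  qed
qed

text \<open>If the transversal average decayed too, all three integrals in
  \<open>charge_split\<close> would tend to 0, although their combination keeps the nonzero value at
  \<open>v0\<close>.\<close>

lemma transversal_derivative_not_decaying:
  assumes ext: "a\<^sup>2 + Q\<^sup>2 = M\<^sup>2" "M > 0" and u: "regular_solution M a Q \<tau>0 u"
    and v0: "\<tau>0 + M \<le> v0" "charge M a u v0 \<noteq> 0"
    and lim: "uniform_limit {0..pi} (\<lambda>v \<theta>. in_coords u v M \<theta> 0) (\<lambda>_. 0) at_top"
      "uniform_limit {0..pi} (\<lambda>v \<theta>. deriv (\<lambda>w. in_coords u w M \<theta> 0) v) (\<lambda>_. 0) at_top"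
  shows "\<not> ((\<lambda>v. integral {0..pi} (\<lambda>\<theta>. deriv (\<lambda>r. in_coords u v r \<theta> 0) M * sin \<theta>)) \<longlongrightarrow> 0) at_top"
proof
  assume I: "((\<lambda>v. integral {0..pi} (\<lambda>\<theta>. deriv (\<lambda>r. in_coords u v r \<theta> 0) M * sin \<theta>)) \<longlongrightarrow> 0) at_top"
  have ev: "\<forall>\<^sub>F v in at_top. v \<ge> \<tau>0 + M" by (rule eventually_ge_at_top)
  have J: "((\<lambda>v. integral {0..pi} (\<lambda>\<theta>. in_coords u v M \<theta> 0 * sin \<theta>)) \<longlongrightarrow> 0) at_top"
    by (rule weighted_integral_tendsto_0[OF lim(1)])
       (auto intro!: continuous_intros eventually_mono[OF ev] horizon_quantities_continuous[OF ext u])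
  have K: "((\<lambda>v. integral {0..pi} (\<lambda>\<theta>. deriv (\<lambda>w. in_coords u w M \<theta> 0) v * (sin \<theta>) ^ 3)) \<longlongrightarrow> 0) at_top"
    by (rule weighted_integral_tendsto_0[OF lim(2)])
       (auto intro!: continuous_intros eventually_mono[OF ev] horizon_quantities_continuous[OF ext u]
          simp: power_abs power_le_one)
  have "((\<lambda>v. 2 * (M\<^sup>2 + a\<^sup>2) * integral {0..pi} (\<lambda>\<theta>. deriv (\<lambda>r. in_coords u v r \<theta> 0) M * sin \<theta>)
    + 2 * M * integral {0..pi} (\<lambda>\<theta>. in_coords u v M \<theta> 0 * sin \<theta>)
    + a\<^sup>2 * integral {0..pi} (\<lambda>\<theta>. deriv (\<lambda>w. in_coords u w M \<theta> 0) v * (sin \<theta>) ^ 3)) \<longlongrightarrow>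
      2 * (M\<^sup>2 + a\<^sup>2) * 0 + 2 * M * 0 + a\<^sup>2 * 0) at_top"
    by (intro tendsto_intros I J K)
  moreover have "\<forall>\<^sub>F v in at_top. 2 * (M\<^sup>2 + a\<^sup>2) * integral {0..pi} (\<lambda>\<theta>. deriv (\<lambda>r. in_coords u v r \<theta> 0) M * sin \<theta>)
    + 2 * M * integral {0..pi} (\<lambda>\<theta>. in_coords u v M \<theta> 0 * sin \<theta>)
    + a\<^sup>2 * integral {0..pi} (\<lambda>\<theta>. deriv (\<lambda>w. in_coords u w M \<theta> 0) v * (sin \<theta>) ^ 3) = charge M a u v0"
    using ev
  proof eventually_elim
    case (elim v)
    then show ?case
      using charge_split[OF ext u elim] charge_constant[OF ext u elim v0(1)] by simp
  qed
  ultimately have "((\<lambda>_::real. charge M a u v0) \<longlongrightarrow> 0) at_top"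
    by (simp add: filterlim_cong)
  then show False
    using v0(2) by (simp add: tendsto_const_iff)
qed


subsection \<open>Stationary states\<close>

context reduced_wave
begin

text \<open>Independence of v is known only for r at least M, not on all of \<open>\<Omega>\<close>.
  Derivatives in v stay inside that region; the r-derivative at the horizon has to be taken from the
  right.\<close>

lemma stationary_derivatives:
  assumes dom: "\<And>v r. dom v r \<longleftrightarrow> M \<le> r"
    and stat: "\<And>v v' r \<theta>. M \<le> r \<Longrightarrow> w (v, r, \<theta>) = w (v', r, \<theta>)"
    and r: "M \<le> r"
  shows "pd dv w (v, r, \<theta>) = 0" "pd dv (pd dv w) (v, r, \<theta>) = 0" "pd dv (pd dr w) (v, r, \<theta>) = 0"
proof -
  have const: "pd dv g (v, r, \<theta>) = 0"
    if g: "smooth_on \<Omega> g" and c: "\<And>v. g (v, r, \<theta>) = g (0, r, \<theta>)" for g v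
  proof -
    have "((\<lambda>v. g (v, r, \<theta>)) has_real_derivative pd dv g (v, r, \<theta>)) (at v)"
      using partial_derivatives(1)[OF g] dom r by blast
    moreover have "(\<lambda>v. g (v, r, \<theta>)) = (\<lambda>_. g (0, r, \<theta>))"
      using c by blast
    ultimately show ?thesis
      using DERIV_unique[OF _ DERIV_const] by metis
  qed
  show wv: "pd dv w (v, r, \<theta>) = 0" for v
    by (rule const[OF smooth]) (rule stat[OF r])
  show "pd dv (pd dv w) (v, r, \<theta>) = 0"
    by (rule const) (auto intro: smooth_derivatives simp: wv)
  have "pd dr w (v, r, \<theta>) = pd dr w (0, r, \<theta>)" for v
  proof -
    \<comment> \<open>The half-line from r upwards lies in the region where the values for v and 0
      agree, and it still determines the derivative.\<close>
    have 1: "((\<lambda>r. w (v, r, \<theta>)) has_real_derivative pd dr w (v, r, \<theta>)) (at r within {r..})"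
      using partial_derivatives(2)[OF smooth] dom r by blast
    have "((\<lambda>r. w (0, r, \<theta>)) has_real_derivative pd dr w (0, r, \<theta>)) (at r within {r..})"
      using partial_derivatives(2)[OF smooth] dom r by blast
    then have 2: "((\<lambda>r. w (v, r, \<theta>)) has_real_derivative pd dr w (0, r, \<theta>)) (at r within {r..})"
      by (rule has_field_derivative_transform_within[OF _ zero_less_one])
         (use r stat in \<open>auto intro: stat\<close>)
    show ?thesis
      using 1 2 unfolding has_field_derivative_iff
      by (rule tendsto_unique[rotated]) (simp add: at_within_Ici_at_right)
  qed
  then show "pd dv (pd dr w) (v, r, \<theta>) = 0"
    by (intro const) (auto intro: smooth_derivatives)
qed

text \<open>The azimuthal integration and the normalisation are dropped: for axisymmetric states
  they contribute only a constant factor.\<close>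

definition sphere_mean_sq :: "real \<Rightarrow> real" where
  "sphere_mean_sq r = integral {0..pi} (\<lambda>\<theta>. (w (0, r, \<theta>))\<^sup>2 * sin \<theta>)"

text \<open>Writing \<open>F\<close> for \<open>sphere_mean_sq\<close>, the stationary equation gives
  \<open>(\<Delta> F')' = 2 \<integral> (\<Delta> (\<partial>\<^sub>r w)\<^sup>2 + (\<partial>\<^sub>\<theta> w)\<^sup>2) sin \<theta> d\<theta> \<ge> 0\<close>, and \<open>\<Delta> F'\<close> vanishes at the horizon.\<close>

lemma sphere_mean_sq_mono:
  assumes dom: "\<And>v r. dom v r \<longleftrightarrow> M \<le> r"
    and stat: "\<And>v v' r \<theta>. M \<le> r \<Longrightarrow> w (v, r, \<theta>) = w (v', r, \<theta>)"
    and r: "M \<le> r" "r \<le> r'"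
  shows "sphere_mean_sq r \<le> sphere_mean_sq r'"
proof -
  define f fr ft frr ftt where "f r \<theta> = w (0, r, \<theta>)" and "fr r \<theta> = pd dr w (0, r, \<theta>)"
    and "ft r \<theta> = pd dth w (0, r, \<theta>)" and "frr r \<theta> = pd dr (pd dr w) (0, r, \<theta>)"
    and "ftt r \<theta> = pd dth (pd dth w) (0, r, \<theta>)" for r \<theta>
  note f_defs = f_def fr_def ft_def frr_def ftt_def
  have eq: "sin \<theta> * (2 * (r - M) * fr r \<theta> + (r - M)\<^sup>2 * frr r \<theta>)
      = - (cos \<theta> * ft r \<theta> + sin \<theta> * ftt r \<theta>)" if "M \<le> r" "0 \<le> \<theta>" "\<theta> \<le> pi" for r \<theta>
    using equation[of 0 r \<theta>] that dom stationary_derivatives[OF dom stat that(1)]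
    by (simp add: f_defs)
  have cont: "continuous_on S (\<lambda>x. f (R x) (\<Theta> x))" "continuous_on S (\<lambda>x. fr (R x) (\<Theta> x))"
    "continuous_on S (\<lambda>x. ft (R x) (\<Theta> x))" "continuous_on S (\<lambda>x. frr (R x) (\<Theta> x))"
    "continuous_on S (\<lambda>x. ftt (R x) (\<Theta> x))"
    if "\<And>x. x \<in> S \<Longrightarrow> M \<le> R x" "continuous_on S R" "continuous_on S \<Theta>"
    for S :: "'b::t2_space set" and R \<Theta>
    unfolding f_defs using that dom
    by (auto intro!: continuous_on_reduced smooth_derivatives continuous_intros)
  have der: "((\<lambda>r. f r \<theta>) has_real_derivative fr r \<theta>) (at r within S)"
    "((\<lambda>r. fr r \<theta>) has_real_derivative frr r \<theta>) (at r within S)"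
    "((\<lambda>\<theta>. f r \<theta>) has_real_derivative ft r \<theta>) (at \<theta> within S)"
    "((\<lambda>\<theta>. ft r \<theta>) has_real_derivative ftt r \<theta>) (at \<theta> within S)"
    if "M \<le> r" for r \<theta> S
    unfolding f_defs using that dom by (auto intro!: partial_derivatives smooth_derivatives)
  define F' where "F' r = integral {0..pi} (\<lambda>\<theta>. 2 * f r \<theta> * fr r \<theta> * sin \<theta>)" for r
  have F: "(sphere_mean_sq has_real_derivative F' r) (at r within {M..})" if "r \<in> {M..}" for r
    unfolding sphere_mean_sq_def[abs_def] F'_def box_real[symmetric] f_def[symmetric]
  proof (rule leibniz_rule_field_derivative)
    show "((\<lambda>r. (f r \<theta>)\<^sup>2 * sin \<theta>) has_real_derivative 2 * f r \<theta> * fr r \<theta> * sin \<theta>) (at r within {M..})"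
      if "r \<in> {M..}" for r \<theta>
      using that by (auto intro!: derivative_eq_intros der)
    show "(\<lambda>\<theta>. (f r \<theta>)\<^sup>2 * sin \<theta>) integrable_on cbox 0 pi" if "r \<in> {M..}" for r
      by (intro integrable_continuous continuous_intros cont) (use that in auto)
    show "continuous_on ({M..} \<times> cbox 0 pi) (\<lambda>(r, \<theta>). 2 * f r \<theta> * fr r \<theta> * sin \<theta>)"
      unfolding case_prod_unfold by (intro continuous_intros cont) auto
  qed (use that in auto)
  \<comment> \<open>\<open>H\<close> is \<Delta> F'. Keeping (r - M)^2 next to \<open>fr\<close>
    makes its r-derivative produce exactly the radial part of the equation.\<close>
  define H where "H r = integral {0..pi} (\<lambda>\<theta>. 2 * f r \<theta> * ((r - M)\<^sup>2 * fr r \<theta>) * sin \<theta>)" for r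
  define h where "h r \<theta> = (2 * fr r \<theta> * ((r - M)\<^sup>2 * fr r \<theta>)
      + 2 * f r \<theta> * (2 * (r - M) * fr r \<theta> + (r - M)\<^sup>2 * frr r \<theta>)) * sin \<theta>" for r \<theta>
  have H: "(H has_real_derivative integral (cbox 0 pi) (h r)) (at r within {M..})" if "r \<in> {M..}" for r
    unfolding H_def[abs_def] box_real[symmetric]
  proof (rule leibniz_rule_field_derivative)
    show "((\<lambda>r. 2 * f r \<theta> * ((r - M)\<^sup>2 * fr r \<theta>) * sin \<theta>) has_real_derivative h r \<theta>) (at r within {M..})"
      if "r \<in> {M..}" for r \<theta>
      unfolding h_def using that by (auto intro!: derivative_eq_intros der simp: algebra_simps)
    show "(\<lambda>\<theta>. 2 * f r \<theta> * ((r - M)\<^sup>2 * fr r \<theta>) * sin \<theta>) integrable_on cbox 0 pi" if "r \<in> {M..}" for r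
      by (intro integrable_continuous continuous_intros cont) (use that in auto)
    show "continuous_on ({M..} \<times> cbox 0 pi) (\<lambda>(r, \<theta>). h r \<theta>)"
      unfolding case_prod_unfold h_def by (intro continuous_intros cont) auto
  qed (use that in auto)
  have h_nonneg: "integral (cbox 0 pi) (h r) \<ge> 0" if "M \<le> r" for r
  proof -
    \<comment> \<open>The integral of the \<theta>-derivative of 2 f sin \<theta> f_\<theta>, which
      vanishes at the poles. Adding it to \<open>h\<close> turns the integrand into squares times
      sin \<theta>.\<close>
    have "((\<lambda>\<theta>. 2 * ft r \<theta> * (sin \<theta> * ft r \<theta>) + 2 * f r \<theta> * (cos \<theta> * ft r \<theta> + sin \<theta> * ftt r \<theta>))
      has_integral 2 * f r pi * (sin pi * ft r pi) - 2 * f r 0 * (sin 0 * ft r 0)) {0..pi}"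
      unfolding has_real_derivative_iff_has_vector_derivative[symmetric]
      by (rule fundamental_theorem_of_calculus)
         (auto intro!: derivative_eq_intros der that
            simp: has_real_derivative_iff_has_vector_derivative[symmetric] algebra_simps)
    then have parts: "((\<lambda>\<theta>. 2 * ft r \<theta> * (sin \<theta> * ft r \<theta>) + 2 * f r \<theta> * (cos \<theta> * ft r \<theta> + sin \<theta> * ftt r \<theta>))
      has_integral 0) {0..pi}" by simp
    have "(h r has_integral integral {0..pi} (h r)) {0..pi}"
      unfolding h_def by (intro integrable_integral integrable_continuous_interval continuous_intros cont)
        (use that in auto)
    from has_integral_add[OF this parts]
    have "((\<lambda>\<theta>. h r \<theta> + (2 * ft r \<theta> * (sin \<theta> * ft r \<theta>) + 2 * f r \<theta> * (cos \<theta> * ft r \<theta> + sin \<theta> * ftt r \<theta>)))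
      has_integral integral {0..pi} (h r)) {0..pi}" by simp
    then show ?thesis
      unfolding box_real
    proof (rule has_integral_nonneg)
      fix \<theta> assume th: "\<theta> \<in> {0..pi}"
      have "h r \<theta> = 2 * ((r - M) * fr r \<theta>)\<^sup>2 * sin \<theta>
          + 2 * f r \<theta> * (sin \<theta> * (2 * (r - M) * fr r \<theta> + (r - M)\<^sup>2 * frr r \<theta>))"
        by (simp add: h_def algebra_simps power2_eq_square)
      also have "\<dots> = 2 * ((r - M) * fr r \<theta>)\<^sup>2 * sin \<theta>
          - 2 * f r \<theta> * (cos \<theta> * ft r \<theta> + sin \<theta> * ftt r \<theta>)"
        by (subst eq[OF that]) (use th in \<open>auto simp: algebra_simps\<close>)
      finally have "h r \<theta> + (2 * ft r \<theta> * (sin \<theta> * ft r \<theta>) + 2 * f r \<theta> * (cos \<theta> * ft r \<theta> + sin \<theta> * ftt r \<theta>))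
          = 2 * ((r - M) * fr r \<theta>)\<^sup>2 * sin \<theta> + 2 * (ft r \<theta>)\<^sup>2 * sin \<theta>"
        by (simp add: power2_eq_square)
      also have "\<dots> \<ge> 0"
        using th by (auto intro!: add_nonneg_nonneg mult_nonneg_nonneg sin_ge_zero)
      finally show "0 \<le> h r \<theta> + (2 * ft r \<theta> * (sin \<theta> * ft r \<theta>)
          + 2 * f r \<theta> * (cos \<theta> * ft r \<theta> + sin \<theta> * ftt r \<theta>))" .
    qed
  qed
  have at_M: "at s within {M..} = at s" if "M < s" for s
    using that by (auto intro!: at_within_interior simp: interior_Ici[of "M - 1"])
  \<comment> \<open>Applied to \<open>H\<close> and to F. The sign is demanded only for r > M,
    because \<open>H\<close> = (r - M)^2 F' gives no information on F' at M.\<close>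
  have mono: "g r \<le> g r'"
    if g: "\<And>r. r \<in> {M..} \<Longrightarrow> (g has_real_derivative g' r) (at r within {M..})"
      and nn: "\<And>r. M < r \<Longrightarrow> g' r \<ge> 0" and r: "M \<le> r" "r \<le> r'" for g g' and r r' :: real
  proof (rule DERIV_nonneg_imp_increasing_open[OF r(2)])
    show "\<exists>y. (g has_real_derivative y) (at x) \<and> 0 \<le> y" if "r < x" "x < r'" for x
      using g[of x] nn[of x] at_M[of x] that r by auto
    have "continuous_on {M..} g"
      using g by (meson DERIV_continuous_on)
    then show "continuous_on {r..r'} g"
      by (rule continuous_on_subset) (use r in auto)
  qed
  \<comment> \<open>The start value \<open>H M\<close> is 0 through the factor (r - M)^2.\<close>
  have H_nonneg: "H r \<ge> 0" if "M \<le> r" for r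
    using mono[of H "\<lambda>r. integral (cbox 0 pi) (h r)" M r] H h_nonneg that by (simp add: H_def)
  have "F' r \<ge> 0" if "M < r" for r
  proof -
    have "H r = (r - M)\<^sup>2 * F' r"
      unfolding H_def F'_def integral_mult_right[symmetric] by (simp add: mult_ac)
    then show ?thesis
      using H_nonneg[of r] that by (simp add: zero_le_mult_iff)
  qed
  then show ?thesis
    using mono[of sphere_mean_sq F' r r'] F r by blast
qed

end

subsection \<open>Spherical coordinates\<close>

lemma measurable_vector_3 [measurable]:
  "(\<lambda>(x, y, z). vector [x, y, z] :: real^3) \<in> borel_measurable (lborel :: (real \<times> real \<times> real) measure)"
proof -
  have "(\<lambda>p::real \<times> real \<times> real. vector [fst p, fst (snd p), snd (snd p)] :: real^3) =
      (\<lambda>p. \<chi> i. if i = 1 then fst p else if i = 2 then fst (snd p) else snd (snd p))"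
    by (auto simp: fun_eq_iff vec_eq_iff forall_3)
  moreover have "continuous_on UNIV (\<lambda>p::real \<times> real \<times> real.
      (\<chi> i. if i = 1 then fst p else if i = 2 then fst (snd p) else snd (snd p)) :: real^3)"
  proof (rule continuous_on_vec_lambda)
    show "continuous_on UNIV (\<lambda>p::real \<times> real \<times> real. if i = 1 then fst p
        else if i = 2 then fst (snd p) else snd (snd p))" for i :: 3
      by (cases "i = 1"; cases "i = 2") (auto intro!: continuous_intros)
  qed
  ultimately show ?thesis
    by (simp add: case_prod_unfold borel_measurable_continuous_onI)
qed

text \<open>Viewing the space as nested pairs opens integrals over it to Tonelli's theorem for
  product measures.\<close>

lemma lborel_vector_3:
  "(lborel :: (real^3) measure) = distr lborel borel (\<lambda>(x, y, z). vector [x, y, z])"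
proof (rule lborel_eqI)
  fix l u :: "real^3" assume le: "\<And>b. b \<in> Basis \<Longrightarrow> l \<bullet> b \<le> u \<bullet> b"
  have le: "l $ i \<le> u $ i" for i
    using le[of "axis i 1"] by (simp add: inner_axis axis_in_Basis_iff)
  have "emeasure (distr lborel borel (\<lambda>(x, y, z). vector [x, y, z])) (box l u)
      = emeasure lborel ((\<lambda>(x, y, z). vector [x, y, z] :: real^3) -` box l u)"
    by (subst emeasure_distr) auto
  also have "(\<lambda>(x, y, z). vector [x, y, z] :: real^3) -` box l u
      = box (l $ 1, l $ 2, l $ 3) (u $ 1, u $ 2, u $ 3)"
    by (auto simp: mem_box_cart forall_3 Basis_coords mem_box[of _ "(l $ 1, l $ 2, l $ 3)"])
  also have "emeasure lborel \<dots> = (\<Prod>b\<in>Basis. (u - l) \<bullet> b)"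
  proof -
    have vol: "emeasure lborel (box (l $ 1, l $ 2, l $ 3) (u $ 1, u $ 2, u $ 3))
        = (\<Prod>b\<in>Basis. ((u $ 1, u $ 2, u $ 3) - (l $ 1, l $ 2, l $ 3)) \<bullet> b)"
      by (rule emeasure_lborel_box) (auto simp: Basis_coords le)
    have B3: "(Basis :: (real^3) set) = {axis 1 1, axis 2 1, axis 3 1}"
      by (auto simp: Basis_vec_def) (metis exhaust_3)
    have "(\<Prod>b\<in>Basis. (u - l) \<bullet> b) = (u $ 1 - l $ 1) * (u $ 2 - l $ 2) * (u $ 3 - l $ 3)"
      unfolding B3 by (simp add: axis_eq_axis inner_axis)
    then show ?thesis
      unfolding vol by (simp add: Basis_coords mult.assoc)
  qed
  finally show "emeasure (distr lborel borel (\<lambda>(x, y, z). vector [x, y, z])) (box l u)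
      = (\<Prod>b\<in>Basis. (u - l) \<bullet> b)" .
qed simp


lemma nn_integral_lborel_pair:
  fixes h :: "'a::euclidean_space \<times> 'b::euclidean_space \<Rightarrow> ennreal"
  assumes "h \<in> borel_measurable borel"
  shows "(\<integral>\<^sup>+p. h p \<partial>lborel) = (\<integral>\<^sup>+x. \<integral>\<^sup>+y. h (x, y) \<partial>lborel \<partial>lborel)"
proof -
  have "h \<in> borel_measurable (lborel \<Otimes>\<^sub>M lborel)"
    using assms by (simp add: lborel_prod)
  from lborel.nn_integral_fst[OF this] show ?thesis
    by (simp add: lborel_prod)
qed

lemma nn_integral_real3_iterated:
  fixes f :: "real^3 \<Rightarrow> ennreal"
  assumes f: "f \<in> borel_measurable borel"
  shows "(\<integral>\<^sup>+x. f x \<partial>lborel) = (\<integral>\<^sup>+x. \<integral>\<^sup>+y. \<integral>\<^sup>+z. f (vector [x, y, z]) \<partial>lborel \<partial>lborel \<partial>lborel)"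
proof -
  define h where "h p = f (case p of (x, y, z) \<Rightarrow> vector [x, y, z])" for p
  have h: "h \<in> borel_measurable borel"
    using measurable_compose[OF measurable_vector_3 f] by (simp add: h_def[abs_def])
  have hx: "(\<lambda>p. h (x, p)) \<in> borel_measurable borel" for x
    by (rule measurable_compose[OF borel_measurable_continuous_onI h]) (auto intro!: continuous_intros)
  have "(\<integral>\<^sup>+x. f x \<partial>lborel) = (\<integral>\<^sup>+p. h p \<partial>lborel)"
    unfolding h_def by (subst lborel_vector_3, subst nn_integral_distr) (auto intro: measurable_vector_3 f)
  also have "\<dots> = (\<integral>\<^sup>+x. \<integral>\<^sup>+y. \<integral>\<^sup>+z. h (x, y, z) \<partial>lborel \<partial>lborel \<partial>lborel)"
    by (simp add: nn_integral_lborel_pair h hx)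
  finally show ?thesis by (simp add: h_def)
qed

lemma det_spherical:
  fixes r \<theta> \<phi> :: real
  defines "J \<equiv> vector [vector [sin \<theta> * cos \<phi>, r * cos \<theta> * cos \<phi>, - r * sin \<theta> * sin \<phi>],
      vector [sin \<theta> * sin \<phi>, r * cos \<theta> * sin \<phi>, r * sin \<theta> * cos \<phi>],
      vector [cos \<theta>, - r * sin \<theta>, 0]] :: real^3^3"
  shows "det J = r\<^sup>2 * sin \<theta>"
proof -
  have "det J = r\<^sup>2 * sin \<theta> * (((cos \<theta>)\<^sup>2 + (sin \<theta>)\<^sup>2) * ((cos \<phi>)\<^sup>2 + (sin \<phi>)\<^sup>2))"
    by (simp add: J_def det_3 algebra_simps power2_eq_square del: sin_cos_squared_add sin_cos_squared_add2
        sin_cos_squared_add3)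
  then show ?thesis
    by (simp only: sin_cos_squared_add2 mult_1_right)
qed

lemma has_derivative_spherical:
  fixes x :: "real^3"
  defines "J \<equiv> vector [vector [sin (x $ 2) * cos (x $ 3), x $ 1 * cos (x $ 2) * cos (x $ 3), - x $ 1 * sin (x $ 2) * sin (x $ 3)],
      vector [sin (x $ 2) * sin (x $ 3), x $ 1 * cos (x $ 2) * sin (x $ 3), x $ 1 * sin (x $ 2) * cos (x $ 3)],
      vector [cos (x $ 2), - x $ 1 * sin (x $ 2), 0]] :: real^3^3"
  shows "((\<lambda>x. sph (x $ 1) (x $ 2) (x $ 3)) has_derivative (*v) J) (at x within S)"
proof -
  have "((\<lambda>x. sph (x $ 1) (x $ 2) (x $ 3) $ k) has_derivative (\<lambda>h. (J *v h) $ k)) (at x within S)" for k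
  proof -
    consider "k = 1" | "k = 2" | "k = 3" using exhaust_3 by blast
    then show ?thesis
    proof cases
      case 1
      then show ?thesis
        by (simp add: matrix_vector_mult_def sum_3 J_def)
           (rule derivative_eq_intros refl | simp add: algebra_simps)+
    next
      case 2
      then show ?thesis
        by (simp add: matrix_vector_mult_def sum_3 J_def)
           (rule derivative_eq_intros refl | simp add: algebra_simps)+
    next
      case 3
      then show ?thesis
        by (simp add: matrix_vector_mult_def sum_3 J_def)
           (rule derivative_eq_intros refl | simp add: algebra_simps)+
    qed
  qed
  then show ?thesis
    by (subst has_derivative_componentwise_within) (auto simp: Basis_vec_def inner_axis)
qed

text \<open>The integral of \<open>K\<close> over a coordinate box is evaluated twice: by change of
  variables it is the integral of \<open>g\<close> over a sector of the shell, and by Tonelli it is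
  at least c (R - r0). The function \<open>k\<close> is \<open>g\<close> with the Jacobian factor
  r^2 absorbed.\<close>

lemma spherical_integral_lower_bound:
  fixes g :: "real^3 \<Rightarrow> real" and k :: "real \<Rightarrow> real \<Rightarrow> real"
  assumes r0: "0 < r0" "r0 \<le> R" and c: "0 \<le> c"
    and k: "continuous_on ({r0..R} \<times> {0..pi}) (\<lambda>(r, \<theta>). k r \<theta>)" "\<And>r \<theta>. 0 \<le> k r \<theta>"
    and g: "\<And>r \<theta> \<phi>. r \<in> {r0..R} \<Longrightarrow> \<theta> \<in> {0..pi} \<Longrightarrow> r\<^sup>2 * g (sph r \<theta> \<phi>) = k r \<theta>"
    and S: "{x. r0 < norm x} \<subseteq> S"
    and lower: "\<And>r. r \<in> {r0..R} \<Longrightarrow> c \<le> integral {0..pi} (\<lambda>\<theta>. k r \<theta> * sin \<theta>)"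
  shows "ennreal (c * (R - r0)) \<le> (\<integral>\<^sup>+x\<in>S. ennreal (g x) \<partial>lborel)"
proof -
  \<comment> \<open>The azimuth runs over (0, 1): length 1 gives factor 1, and staying below pi
    keeps cosine injective. The open box avoids poles; its closure \<open>C\<close> is compact, for
    integrability.\<close>
  define B where "B = box (vector [r0, 0, 0]) (vector [R, pi, 1] :: real^3)"
  define C where "C = cbox (vector [r0, 0, 0]) (vector [R, pi, 1] :: real^3)"
  have memB: "x \<in> B \<longleftrightarrow> r0 < x $ 1 \<and> x $ 1 < R \<and> 0 < x $ 2 \<and> x $ 2 < pi \<and> 0 < x $ 3 \<and> x $ 3 < 1" for x
    by (auto simp: B_def mem_box_cart forall_3)
  have memC: "x \<in> C \<longleftrightarrow> r0 \<le> x $ 1 \<and> x $ 1 \<le> R \<and> 0 \<le> x $ 2 \<and> x $ 2 \<le> pi \<and> 0 \<le> x $ 3 \<and> x $ 3 \<le> 1" for x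
    by (auto simp: C_def mem_box_cart forall_3)
  have BC: "B \<subseteq> C" by (auto simp: memB memC)
  define K where "K x = k (x $ 1) (x $ 2) * sin (x $ 2)" for x :: "real^3"
  have K_nonneg: "K x \<ge> 0" if "x \<in> C" for x
    using that k(2) by (auto simp: K_def memC sin_ge_zero)
  have contK: "continuous_on C K"
  proof -
    have "continuous_on C (\<lambda>x. (\<lambda>(r, \<theta>). k r \<theta>) (x $ 1, x $ 2))"
      by (rule continuous_on_compose2[OF k(1)]) (auto simp: memC intro!: continuous_intros)
    then show ?thesis
      unfolding K_def by (auto intro!: continuous_intros)
  qed
  \<comment> \<open>A real function written as a one-component vector, the codomain in which the
    change of variables is applied.\<close>
  define V :: "real^3 \<Rightarrow> real^1" where "V x = vec (K x)" for x
  define G where "G x = sph (x $ 1) (x $ 2) (x $ 3)" for x :: "real^3"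
  define J where "J x = (vector [vector [sin (x $ 2) * cos (x $ 3), x $ 1 * cos (x $ 2) * cos (x $ 3), - x $ 1 * sin (x $ 2) * sin (x $ 3)],
      vector [sin (x $ 2) * sin (x $ 3), x $ 1 * cos (x $ 2) * sin (x $ 3), x $ 1 * sin (x $ 2) * cos (x $ 3)],
      vector [cos (x $ 2), - x $ 1 * sin (x $ 2), 0]] :: real^3^3)" for x :: "real^3"
  have Vint: "V absolutely_integrable_on B"
  proof -
    have "continuous_on C V"
      unfolding V_def vec_def by (intro continuous_on_vec_lambda contK)
    then show ?thesis
      unfolding B_def C_def absolutely_integrable_on_open_interval by (rule absolutely_integrable_continuous)
  qed
  have V_eq: "\<bar>det (matrix ((*v) (J x)))\<bar> *\<^sub>R vec (g (G x)) = V x" if "x \<in> B" for x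
  proof -
    have "0 \<le> sin (x $ 2)" using that by (simp add: memB sin_ge_zero)
    then have "\<bar>det (matrix ((*v) (J x)))\<bar> = (x $ 1)\<^sup>2 * sin (x $ 2)"
      unfolding J_def matrix_of_matrix_vector_mul det_spherical by (simp add: abs_mult)
    moreover have "(x $ 1)\<^sup>2 * g (G x) = k (x $ 1) (x $ 2)"
      unfolding G_def using that by (intro g) (auto simp: memB)
    ultimately show ?thesis
      by (simp add: V_def K_def vec_eq_iff mult_ac)
  qed
  have "(\<lambda>x. vec (g x) :: real^1) absolutely_integrable_on (G ` B) \<and>
      integral (G ` B) (\<lambda>x. vec (g x) :: real^1) = integral B V"
  proof (subst has_absolute_integral_change_of_variables[symmetric, where g'="\<lambda>x. (*v) (J x)"])
    show "B \<in> sets lebesgue" by (simp add: B_def)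
    show "(G has_derivative (*v) (J x)) (at x within B)" for x
      unfolding G_def J_def by (rule has_derivative_spherical)
    show "inj_on G B"
    proof (rule inj_onI)
      fix x y assume xy: "x \<in> B" "y \<in> B" "G x = G y"
      have r: "x $ 1 = y $ 1"
        using arg_cong[OF xy(3), of norm] xy(1,2) r0 by (simp add: G_def memB)
      have "x $ 1 * cos (x $ 2) = y $ 1 * cos (y $ 2)"
        using arg_cong[OF xy(3), of "\<lambda>z. z $ 3"] by (simp add: G_def)
      moreover have y1: "y $ 1 \<noteq> 0" using xy(2) r0 by (auto simp: memB)
      ultimately have "cos (x $ 2) = cos (y $ 2)" unfolding r by simp
      \<comment> \<open>Injectivity is read off in turn from the norm, the third component and the
        first component, the last two through injectivity of cosine on [0, pi].\<close>
      have bounds: "0 \<le> x $ 2" "x $ 2 \<le> pi" "0 \<le> y $ 2" "y $ 2 \<le> pi"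
        "0 \<le> x $ 3" "x $ 3 \<le> pi" "0 \<le> y $ 3" "y $ 3 \<le> pi"
        using xy(1,2) pi_gt3 by (simp_all add: memB)
      have th: "x $ 2 = y $ 2"
        by (rule cos_inj_pi[OF bounds(1-4)]) fact
      have "x $ 1 * sin (x $ 2) * cos (x $ 3) = y $ 1 * sin (y $ 2) * cos (y $ 3)"
        using arg_cong[OF xy(3), of "\<lambda>z. z $ 1"] by (simp add: G_def)
      moreover have "sin (y $ 2) > 0"
        using xy(2) by (intro sin_gt_zero) (auto simp: memB)
      ultimately have "cos (x $ 3) = cos (y $ 3)" unfolding r th using y1 by simp
      then have "x $ 3 = y $ 3"
        by (rule cos_inj_pi[OF bounds(5-8)])
      then show "x = y" using r th by (simp add: vec_eq_iff forall_3)
    qed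
    show "(\<lambda>x. \<bar>det (matrix ((*v) (J x)))\<bar> *\<^sub>R vec (g (G x)) :: real^1) absolutely_integrable_on B \<and>
        integral B (\<lambda>x. \<bar>det (matrix ((*v) (J x)))\<bar> *\<^sub>R vec (g (G x)) :: real^1) = integral B V"
    proof
      show "(\<lambda>x. \<bar>det (matrix ((*v) (J x)))\<bar> *\<^sub>R vec (g (G x)) :: real^1) absolutely_integrable_on B"
        using Vint by (subst set_integrable_cong[OF refl refl V_eq])
      show "integral B (\<lambda>x. \<bar>det (matrix ((*v) (J x)))\<bar> *\<^sub>R vec (g (G x)) :: real^1) = integral B V"
        using V_eq by (rule integral_cong)
    qed
  qed
  then have "((\<lambda>x. vec (g x) :: real^1) has_integral integral B V) (G ` B)"
    using set_lebesgue_integral_eq_integral(1) by (metis integrable_integral)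
  from has_integral_linear[OF this bounded_linear_vec_nth[of 1]]
  have g_int: "(g has_integral integral B V $ 1) (G ` B)" by (simp add: o_def)
  have "(V has_integral integral B V) B"
    using Vint set_lebesgue_integral_eq_integral(1) by (metis integrable_integral)
  from has_integral_linear[OF this bounded_linear_vec_nth[of 1]]
  have K_int: "(K has_integral integral B V $ 1) B" by (simp add: o_def V_def)
  have g_nonneg: "g y \<ge> 0" if "y \<in> G ` B" for y
  proof -
    from that obtain x where x: "x \<in> B" "y = G x" by blast
    have "(x $ 1)\<^sup>2 * g y = k (x $ 1) (x $ 2)"
      unfolding x(2) G_def using x(1) by (intro g) (auto simp: memB)
    moreover have "(x $ 1)\<^sup>2 > 0" using x(1) r0 by (auto simp: memB)
    ultimately show ?thesis using k(2) by (metis zero_le_mult_iff not_less)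
  qed
  have "ennreal (c * (R - r0)) = (\<integral>\<^sup>+x. ennreal c * indicator {r0<..<R} x \<partial>lborel)"
    using r0 c by (simp add: nn_integral_cmult_indicator ennreal_mult)
  \<comment> \<open>At fixed radius the azimuthal integral is 1 and the polar integral is the one
    bounded below in \<open>lower\<close>.\<close>
  also have "\<dots> \<le> (\<integral>\<^sup>+x. \<integral>\<^sup>+y. \<integral>\<^sup>+z. ennreal (K (vector [x, y, z])) * indicator B (vector [x, y, z]) \<partial>lborel \<partial>lborel \<partial>lborel)"
  proof (rule nn_integral_mono)
    fix x :: real
    show "ennreal c * indicator {r0<..<R} x \<le>
        (\<integral>\<^sup>+y. \<integral>\<^sup>+z. ennreal (K (vector [x, y, z])) * indicator B (vector [x, y, z]) \<partial>lborel \<partial>lborel)"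
    proof (cases "x \<in> {r0<..<R}")
      case True
      then have x: "x \<in> {r0..R}" by auto
      have "(\<integral>\<^sup>+z. ennreal (K (vector [x, y, z])) * indicator B (vector [x, y, z]) \<partial>lborel)
          = ennreal (k x y * sin y) * indicator {0<..<pi} y" for y
      proof -
        have "(\<integral>\<^sup>+z. ennreal (K (vector [x, y, z])) * indicator B (vector [x, y, z]) \<partial>lborel)
            = (\<integral>\<^sup>+z. (ennreal (k x y * sin y) * indicator {0<..<pi} y) * indicator {0<..<1::real} z \<partial>lborel)"
          using True by (intro nn_integral_cong) (auto simp: indicator_def memB K_def)
        then show ?thesis
          by (simp add: nn_integral_cmult_indicator)
      qed
      moreover have "(\<integral>\<^sup>+y. ennreal (k x y * sin y) * indicator {0<..<pi} y \<partial>lborel)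
          = ennreal (integral {0..pi} (\<lambda>y. k x y * sin y))"
      proof (rule nn_integral_has_integral_lebesgue')
        have "continuous_on {0..pi} (\<lambda>y. (\<lambda>(r, \<theta>). k r \<theta>) (x, y))"
          by (rule continuous_on_compose2[OF k(1)]) (use x in \<open>auto intro!: continuous_intros\<close>)
        then have "((\<lambda>y. k x y * sin y) has_integral integral {0..pi} (\<lambda>y. k x y * sin y)) {0..pi}"
          by (intro integrable_integral integrable_continuous_interval continuous_intros) simp
        then show "((\<lambda>y. k x y * sin y) has_integral integral {0..pi} (\<lambda>y. k x y * sin y)) {0<..<pi}"
          by (simp add: has_integral_Icc_iff_Ioo)
      qed (use k(2) in \<open>auto simp: sin_ge_zero\<close>)
      ultimately show ?thesis
        using lower[OF x] True by (simp add: ennreal_leI)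
    qed simp
  qed
  also have "\<dots> = (\<integral>\<^sup>+x. ennreal (K x) * indicator B x \<partial>lborel)"
  proof (rule nn_integral_real3_iterated[symmetric])
    have "(\<lambda>x. indicator B x *\<^sub>R K x) \<in> borel_measurable borel"
      by (rule borel_measurable_continuous_on_indicator) (use contK BC in \<open>auto simp: B_def intro: continuous_on_subset\<close>)
    then have "(\<lambda>x. ennreal (indicator B x *\<^sub>R K x)) \<in> borel_measurable borel"
      by measurable
    also have "(\<lambda>x. ennreal (indicator B x *\<^sub>R K x)) = (\<lambda>x. ennreal (K x) * indicator B x)"
      by (auto simp: indicator_def)
    finally show "(\<lambda>x. ennreal (K x) * indicator B x) \<in> borel_measurable borel" .
  qed
  also have "\<dots> = ennreal (integral B V $ 1)"
    by (rule nn_integral_has_integral_lebesgue'[OF _ K_int]) (use K_nonneg BC in auto)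
  also have "\<dots> = (\<integral>\<^sup>+x\<in>G ` B. ennreal (g x) \<partial>lborel)"
    by (rule nn_integral_has_integral_lebesgue'[OF _ g_int, symmetric]) (rule g_nonneg)
  also have "\<dots> \<le> (\<integral>\<^sup>+x\<in>S. ennreal (g x) \<partial>lborel)"
  proof -
    have "G ` B \<subseteq> S" using S r0 by (auto simp: G_def memB)
    then show ?thesis
      by (intro nn_integral_mono) (auto simp: indicator_def)
  qed
  finally show ?thesis .
qed


subsection \<open>The radiation space\<close>

text \<open>Finiteness of the weighted integral passes to the closure: one approximant at squared
  distance below 1, and (x + y)^2 at most 2 x^2 + 2 y^2.\<close>

lemma radiation_space_finite:
  assumes ext: "a\<^sup>2 + Q\<^sup>2 = M\<^sup>2" "M > 0" and u: "radiation_space M a Q u0 u1"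
  shows "(\<integral>\<^sup>+x\<in>exterior M a Q. ennreal ((u0 x)\<^sup>2 / (norm x)\<^sup>2) \<partial>lborel) < top"
proof -
  define S where "S = exterior M a Q"
  have S: "closed S" "0 \<notin> S"
    using ext(2) unfolding S_def exterior_def r_plus_extremal[OF ext(1)]
    by (auto intro!: closed_Collect_le continuous_intros)
  define I where "I f = (\<integral>\<^sup>+x\<in>S. ennreal ((f x)\<^sup>2 / (norm x)\<^sup>2) \<partial>lborel)" for f
  have I_le: "I f \<le> energy_sq S 1 f f1" for f f1
    by (simp add: I_def energy_sq_def)
  \<comment> \<open>Only continuity on \<open>S\<close> is given, so measurability is proved for the
    product with the indicator.\<close>
  have meas: "(\<lambda>x. ennreal ((f x)\<^sup>2 / (norm x)\<^sup>2) * indicator S x) \<in> borel_measurable lborel"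
    if "continuous_on S f" for f
  proof -
    have "(\<lambda>x. indicator S x *\<^sub>R ((f x)\<^sup>2 / (norm x)\<^sup>2)) \<in> borel_measurable borel"
      using S that by (intro borel_measurable_continuous_on_indicator continuous_intros) auto
    then have "(\<lambda>x. ennreal (indicator S x *\<^sub>R ((f x)\<^sup>2 / (norm x)\<^sup>2))) \<in> borel_measurable lborel"
      by measurable
    also have "(\<lambda>x. ennreal (indicator S x *\<^sub>R ((f x)\<^sup>2 / (norm x)\<^sup>2)))
        = (\<lambda>x. ennreal ((f x)\<^sup>2 / (norm x)\<^sup>2) * indicator S x)"
      by (auto simp: indicator_def)
    finally show ?thesis .
  qed
  have cont: "continuous_on S f" if "smooth_up_to S f" for f
    using that smooth_on_continuous continuous_on_subset unfolding smooth_up_to_def by blast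
  obtain f0 f1 where f: "\<And>n::nat. decaying_data M a Q (f0 n) (f1 n)"
    "(\<lambda>n. energy_sq S 1 (\<lambda>x. u0 x - f0 n x) (\<lambda>x. u1 x - f1 n x)) \<longlonglongrightarrow> 0"
    using u unfolding radiation_space_def S_def by blast
  have "\<forall>\<^sub>F n in sequentially. energy_sq S 1 (\<lambda>x. u0 x - f0 n x) (\<lambda>x. u1 x - f1 n x) < 1"
    using order_tendstoD(2)[OF f(2)] by simp
  then obtain n where n: "energy_sq S 1 (\<lambda>x. u0 x - f0 n x) (\<lambda>x. u1 x - f1 n x) < 1"
    using eventually_happens'[OF sequentially_bot] by blast
  define d where "d = (\<lambda>x. u0 x - f0 n x)"
  have cu: "continuous_on S u0" and cf: "continuous_on S (f0 n)"
    using u f(1)[of n] cont by (auto simp: radiation_space_def decaying_data_def S_def)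
  have "continuous_on S d"
    unfolding d_def by (intro continuous_intros cu cf)
  note meas_d = meas[OF this] and meas_f = meas[OF cf]
  have fin: "I d < top" "I (f0 n) < top"
    using le_less_trans[OF I_le[of d] n[folded d_def]] ennreal_one_less_top
      le_less_trans[OF I_le[of "f0 n" "f1 n"]] f(1)[of n]
    by (auto simp: decaying_data_def S_def[symmetric] d_def intro: less_trans)
  have "I u0 \<le> (\<integral>\<^sup>+x. 2 * (ennreal ((d x)\<^sup>2 / (norm x)\<^sup>2) * indicator S x)
      + 2 * (ennreal ((f0 n x)\<^sup>2 / (norm x)\<^sup>2) * indicator S x) \<partial>lborel)"
    unfolding I_def
  proof (rule nn_integral_mono)
    fix x
    have "(u0 x)\<^sup>2 \<le> 2 * (d x)\<^sup>2 + 2 * (f0 n x)\<^sup>2"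
      using sum_squares_bound[of "d x" "f0 n x"] by (simp add: d_def power2_eq_square algebra_simps)
    then have "(u0 x)\<^sup>2 / (norm x)\<^sup>2 \<le> 2 * ((d x)\<^sup>2 / (norm x)\<^sup>2) + 2 * ((f0 n x)\<^sup>2 / (norm x)\<^sup>2)"
      by (simp add: divide_right_mono flip: add_divide_distrib)
    then have "ennreal ((u0 x)\<^sup>2 / (norm x)\<^sup>2)
        \<le> 2 * ennreal ((d x)\<^sup>2 / (norm x)\<^sup>2) + 2 * ennreal ((f0 n x)\<^sup>2 / (norm x)\<^sup>2)"
      by (simp add: ennreal_mult''[symmetric] ennreal_plus[symmetric] ennreal_leI flip: ennreal_numeral del: ennreal_plus)
    then show "ennreal ((u0 x)\<^sup>2 / (norm x)\<^sup>2) * indicator S x \<le>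
        2 * (ennreal ((d x)\<^sup>2 / (norm x)\<^sup>2) * indicator S x)
      + 2 * (ennreal ((f0 n x)\<^sup>2 / (norm x)\<^sup>2) * indicator S x)"
      by (simp add: indicator_def)
  qed
  also have "\<dots> = 2 * I d + 2 * I (f0 n)"
    unfolding I_def
    unfolding nn_integral_cmult[OF meas_d, symmetric] nn_integral_cmult[OF meas_f, symmetric]
    by (rule nn_integral_add; rule borel_measurable_times_ennreal[OF borel_measurable_const])
       (rule meas_d meas_f)+
  also have "\<dots> < top"
    using fin by (simp add: ennreal_mult_less_top)
  finally show ?thesis by (simp add: I_def S_def)
qed

text \<open>Since r^2 times u^2 / r^2 is u^2, the finite weighted integral dominates c (R - r0) for
  every R once \<open>sphere_mean_sq\<close> equals c at r0. This forces c = 0.\<close>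

lemma stationary_state_eq_0:
  assumes ext: "a\<^sup>2 + Q\<^sup>2 = M\<^sup>2" "M > 0" and u: "stationary_state M a Q u"
    and rad: "radiation_space M a Q (slice 0 u) (slice_dt 0 u)" and x: "x \<in> exterior M a Q"
  shows "u (v, x) = 0"
proof -
  have exterior: "exterior M a Q = {x. M \<le> norm x}"
    by (simp add: exterior_def r_plus_extremal[OF ext(1)])
  define D where "D = (UNIV :: real set) \<times> exterior M a Q"
  obtain W where W: "D \<subseteq> W" "smooth_on W u"
    using u by (auto simp: stationary_state_def smooth_up_to_def D_def)
  have box: "solves_box M a Q D u (\<lambda>_. 0)" and ax: "axisymmetric D u"
    and stat: "\<And>v v' x. x \<in> exterior M a Q \<Longrightarrow> u (v, x) = u (v', x)"
    using u by (auto simp: stationary_state_def D_def)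
  have future: "future M a Q \<tau>0 \<subseteq> D" for \<tau>0
    by (auto simp: future_def D_def)
  define w where "w = (\<lambda>p. u (coord p))"
  have w: "w (v, r, \<theta>) = u (v, sph r \<theta> 0)" for v r \<theta>
    by (simp add: w_def coord_def)
  interpret reduced_wave M a "\<lambda>v r. M \<le> r" "coord -` W" w
  proof
    show "smooth_on (coord -` W) w"
      unfolding w_def by (rule smooth_on_coord[OF W(2)])
    show "(v, r, \<theta>) \<in> coord -` W" if "M \<le> r" for v r \<theta>
      using that W(1) ext(2) by (auto simp: coord_def D_def exterior)
    show "sin \<theta> * (a\<^sup>2 * (sin \<theta>)\<^sup>2 * pd dv (pd dv w) (v, r, \<theta>) + 2 * (r - M) * pd dr w (v, r, \<theta>)
      + (r - M)\<^sup>2 * pd dr (pd dr w) (v, r, \<theta>) + 2 * r * pd dv w (v, r, \<theta>)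
      + 2 * (r\<^sup>2 + a\<^sup>2) * pd dv (pd dr w) (v, r, \<theta>))
    + cos \<theta> * pd dth w (v, r, \<theta>) + sin \<theta> * pd dth (pd dth w) (v, r, \<theta>) = 0"
      if "M \<le> r" "0 \<le> \<theta>" "\<theta> \<le> pi" for v r \<theta>
    \<comment> \<open>Each point lies on the slice \<tau>0 = v - r, so the equation on the future of
      that slice applies to it.\<close>
    proof (rule reduced_wave_equation[OF ext _ W(2), of "v - r"])
      show "solves_box M a Q (future M a Q (v - r)) u (\<lambda>_. 0)"
        using box future unfolding solves_box_def by blast
      show "axisymmetric (future M a Q (v - r)) u"
        using ax future unfolding axisymmetric_def by blast
    qed (use that W future in \<open>auto simp: w_def\<close>)
  qed
  have wstat: "w (v, r, \<theta>) = w (v', r, \<theta>)" if "M \<le> r" for v v' r \<theta>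
    unfolding w using that ext(2) by (intro stat) (simp add: exterior)
  have u_w: "u (v, sph r \<theta> \<phi>) = w (0, r, \<theta>)" if "M \<le> r" for v r \<theta> \<phi>
  proof -
    have "u (v, sph r \<theta> \<phi>) = u (v, sph r \<theta> 0)"
      by (rule axisymmetric_sph[OF W ax]) (use that ext(2) in \<open>simp add: D_def exterior\<close>)
    then show ?thesis using wstat[OF that] by (simp add: w)
  qed
  have mono: "sphere_mean_sq r \<le> sphere_mean_sq r'" if "M \<le> r" "r \<le> r'" for r r'
    by (rule sphere_mean_sq_mono) (use that wstat in auto)
  have cont: "continuous_on {0..pi} (\<lambda>\<theta>. w (0, r, \<theta>))" if "M \<le> r" for r
    by (rule continuous_on_reduced[OF smooth]) (use that in \<open>auto intro!: continuous_intros\<close>)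
  have nonneg: "0 \<le> sphere_mean_sq r" if "M \<le> r" for r
    unfolding sphere_mean_sq_def
    by (rule integral_nonneg)
       (auto intro!: integrable_continuous_interval continuous_intros cont that sin_ge_zero mult_nonneg_nonneg)
  have zero: "sphere_mean_sq r0 = 0" if r0: "M \<le> r0" for r0
  proof (rule ccontr)
    define c where "c = sphere_mean_sq r0"
    assume "sphere_mean_sq r0 \<noteq> 0"
    then have c: "c > 0" using nonneg[OF r0] by (simp add: c_def)
    define g where "g x = (slice 0 u x)\<^sup>2 / (norm x)\<^sup>2" for x
    obtain e where e: "e \<ge> 0" "(\<integral>\<^sup>+x\<in>exterior M a Q. ennreal (g x) \<partial>lborel) = ennreal e"
      using radiation_space_finite[OF ext rad] unfolding g_def less_top_ennreal by blast
    \<comment> \<open>Makes the lower bound equal to e + 1, exceeding the finite value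
      \<open>e\<close> of the integral.\<close>
    define R where "R = r0 + (e + 1) / c"
    have R: "r0 \<le> R" "c * (R - r0) = e + 1" using c e(1) by (auto simp: R_def)
    have "ennreal (c * (R - r0)) \<le> (\<integral>\<^sup>+x\<in>exterior M a Q. ennreal (g x) \<partial>lborel)"
    proof (rule spherical_integral_lower_bound[where k="\<lambda>r \<theta>. (w (0, r, \<theta>))\<^sup>2"])
      show "0 < r0" using r0 ext(2) by simp
      show "continuous_on ({r0..R} \<times> {0..pi}) (\<lambda>(r, \<theta>). (w (0, r, \<theta>))\<^sup>2)"
        unfolding case_prod_unfold
        by (intro continuous_intros continuous_on_reduced[OF smooth]) (use r0 in auto)
      show "r\<^sup>2 * g (sph r \<theta> \<phi>) = (w (0, r, \<theta>))\<^sup>2" if "r \<in> {r0..R}" for r \<theta> \<phi>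
        using that r0 ext(2) u_w[of r] by (simp add: g_def slice_def)
      show "{x. r0 < norm x} \<subseteq> exterior M a Q"
        using r0 by (auto simp: exterior)
      show "c \<le> integral {0..pi} (\<lambda>\<theta>. (w (0, r, \<theta>))\<^sup>2 * sin \<theta>)" if "r \<in> {r0..R}" for r
        using mono[of r0 r] that r0 by (simp add: c_def sphere_mean_sq_def)
    qed (use R c in auto)
    then show False using e R by simp
  qed
  have w0: "w (0, r, \<theta>) = 0" if r: "M \<le> r" and th: "0 \<le> \<theta>" "\<theta> \<le> pi" for r \<theta>
  proof -
    have "((\<lambda>\<theta>. (w (0, r, \<theta>))\<^sup>2 * sin \<theta>) has_integral 0) (cbox 0 pi)"
      using integrable_integral[OF integrable_continuous_interval, of 0 pi "\<lambda>\<theta>. (w (0, r, \<theta>))\<^sup>2 * sin \<theta>"]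
        zero[OF r] cont[OF r] by (simp add: sphere_mean_sq_def continuous_intros)
    then have vanish: "(w (0, r, \<theta>))\<^sup>2 * sin \<theta> = 0" if "\<theta> \<in> {0..pi}" for \<theta>
      by (rule has_integral_0_cbox_imp_0[rotated 2])
         (use that cont[OF r] pi_gt_zero in \<open>auto intro!: continuous_intros mult_nonneg_nonneg sin_ge_zero simp: not_le\<close>)
    have "w (0, r, \<theta>) = 0" if "\<theta> \<in> {0<..<pi}" for \<theta>
      using vanish[of \<theta>] sin_gt_zero[of \<theta>] that by auto
    \<comment> \<open>The weight sin \<theta> hides the poles from the integral; the values there
      follow by continuity.\<close>
    then show ?thesis
      using continuous_constant_on_closure[of "{0<..<pi}" "\<lambda>\<theta>. w (0, r, \<theta>)" 0 \<theta>] cont[OF r] th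
      by (simp add: closure_greaterThanLessThan)
  qed
  obtain \<theta> \<phi> where "0 \<le> \<theta>" "\<theta> \<le> pi" "x = sph (norm x) \<theta> \<phi>"
    using sph_surj by blast
  then show ?thesis
    using u_w[of "norm x" v \<theta> \<phi>] w0[of "norm x" \<theta>] x by (simp add: exterior)
qed

section \<open>Failure of the package at extremality\<close>

lemma not_BH1_extremal:
  assumes "a\<^sup>2 + Q\<^sup>2 = M\<^sup>2"
  shows "\<not> BH1 M a Q"
proof -
  \<comment> \<open>With vanishing discriminant \<open>r_plus\<close> and \<open>r_minus\<close>
    coincide. Failure of this one condition refutes the package for every choice of
    \<open>other\<close>.\<close>
  have "M\<^sup>2 - a\<^sup>2 - Q\<^sup>2 = 0" using assms by simp
  then have "surface_gravity M a Q = 0"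
    unfolding surface_gravity_def r_plus_def r_minus_def by simp
  then show ?thesis by (simp add: BH1_def)
qed

theorem theorem1p14:
  fixes M a Q :: real
  assumes "M > 0" and "a\<^sup>2 + Q\<^sup>2 = M\<^sup>2"
  shows
    "(\<forall>\<tau>0 u. regular_solution M a Q \<tau>0 u \<longrightarrow>
        (\<forall>v \<ge> \<tau>0 + M. (charge M a u has_real_derivative 0) (at v within {\<tau>0 + M..})))
   \<and> (\<forall>other. \<not> bh_package other M a Q)
   \<and> (\<forall>\<tau>0 u v0.
        regular_solution M a Q \<tau>0 u \<and> \<tau>0 + M \<le> v0 \<and> charge M a u v0 \<noteq> 0 \<and>
        uniform_limit {0..pi} (\<lambda>v \<theta>. in_coords u v M \<theta> 0) (\<lambda>_. 0) at_top \<and>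
        uniform_limit {0..pi} (\<lambda>v \<theta>. deriv (\<lambda>w. in_coords u w M \<theta> 0) v) (\<lambda>_. 0) at_top
        \<longrightarrow>
        \<not> ((\<lambda>v. integral {0..pi} (\<lambda>\<theta>. deriv (\<lambda>r. in_coords u v r \<theta> 0) M * sin \<theta>))
              \<longlongrightarrow> 0) at_top)
   \<and> (\<forall>u. stationary_state M a Q u \<and> radiation_space M a Q (slice 0 u) (slice_dt 0 u) \<longrightarrow>
        (\<forall>v. \<forall>x\<in>exterior M a Q. u (v, x) = 0))"
  using charge_conserved[OF assms(2,1)] transversal_derivative_not_decaying[OF assms(2,1)]
    stationary_state_eq_0[OF assms(2,1)] not_BH1_extremal[OF assms(2)]
  by (intro conjI) (blast | simp add: bh_package_def)+

end
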